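(* Let $m\geq0$, $r\geq2$ and $0\leq i\leq r-1$ be integers. Then \[ \sum_{s_1\geq\dots\geq s_{r}\geq-\lfloor m/2\rfloor}\frac{q^{s_1^2+\dots+s_{r}^2+m(s_1+\dots+s_{r-1}+s_r/2)-s_1-\dots-s_{i}}(-q^{m/2})_{s_r}}{(q)_{s_1-s_2}\cdots(q)_{s_{r-1}-s_{r}}(-q^{1+m/2})_{s_{r-1}}}(-1)^{s_r}\begin{bmatrix}m+s_r\\ m+2s_r\end{bmatrix}=b_m, \] where (the sum on the left running over integers $s_1,\dots,s_r$, and $s_1+\dots+s_i=0$ when $i=0$) for every integer $p\ge0$, \[ b_{2p}=\frac{1+q^p}{2(q)_\infty}\sum_{k=0}^{i}\sum_{\ell=0}^{2p}(-1)^\ell q^{2pk+p\ell}(q^{2r},q^{2pr+r-i-p+2k+\ell},q^{r+i-2pr+p-2k-\ell};q^{2r})_\infty, \] \[ b_{2p+1}=(-1)^pq^{(1-r)p^2+(1+2i-2r)p/2}\frac{1+q^{(2p+1)/2}}{2(q)_\infty}\sum_{k=0}^i\sum_{\ell=0}^pq^{k+\ell}\Big((q^{2r},q^{2r-i-p+2k+2\ell-1/2},q^{i+p-2k-2\ell+1/2};q^{2r})_\infty - q^{1/2}(q^{2r},q^{2r-i-p+2k+2\ell+1/2},q^{i+p-2k-2\ell-1/2};q^{2r})_\infty\Big). \]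
   Context: $q$ is a complex number with $|q|<1$ and $q^{1/2}$ is a fixed square root, with $q^{x/2}=(q^{1/2})^x$ for integers $x$. For complex $y$ and base $p'$ with $|p'|<1$, $(y;p')_\infty=\prod_{j\ge0}(1-yp'^j)$, $(y;p')_k=(y;p')_\infty/(yp'^k;p')_\infty$ for $k\in\mathbb{Z}$, $(y)_k=(y;q)_k$, and $(y_1,\dots,y_m;p')_\infty=\prod_i(y_i;p')_\infty$. For integers $N\ge0$ and $j$, $\begin{bmatrix}N\\ j\end{bmatrix}=\frac{(q)_N}{(q)_j(q)_{N-j}}$ if $0\le j\le N$ and $0$ otherwise. *)

theory Defs
  imports "HOL-Analysis.Analysis"
begin

definition qpoch_inf :: "complex \<Rightarrow> complex \<Rightarrow> complex" where
  "qpoch_inf y b = (\<Prod>j. 1 - y * b ^ j)"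

definition qpoch :: "complex \<Rightarrow> complex \<Rightarrow> int \<Rightarrow> complex" where
  "qpoch y b k = qpoch_inf y b / qpoch_inf (y * b powi k) b"

definition qpoch_inf3 :: "complex \<Rightarrow> complex \<Rightarrow> complex \<Rightarrow> complex \<Rightarrow> complex" where
  "qpoch_inf3 y1 y2 y3 b = qpoch_inf y1 b * qpoch_inf y2 b * qpoch_inf y3 b"

definition qbinom :: "complex \<Rightarrow> int \<Rightarrow> int \<Rightarrow> complex" where
  "qbinom q N j =
     (if 0 \<le> j \<and> j \<le> N then qpoch q q N / (qpoch q q j * qpoch q q (N - j)) else 0)"

text \<open>
  Throughout, \<open>h\<close> is the fixed square root of \<open>q\<close>, so that \<open>h powi x\<close> stands for \<open>q\<close> to the
  power \<open>x / 2\<close>; every power of \<open>q\<close> with a half-integral exponent is written as a power of \<open>h\<close>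
  with twice that exponent.

  The summation indices are the integer tuples \<open>(s 1, \<dots>, s r)\<close>, encoded as functions that are
  undefined outside \<open>{1..r}\<close> so that each tuple occurs exactly once.
\<close>

definition index_tuples :: "nat \<Rightarrow> nat \<Rightarrow> (nat \<Rightarrow> int) set" where
  "index_tuples m r =
     {s \<in> {1..r} \<rightarrow>\<^sub>E UNIV. (\<forall>j\<in>{1..<r}. s j \<ge> s (j + 1)) \<and> s r \<ge> - \<lfloor>real m / 2\<rfloor>}"

definition lhs_term ::
  "complex \<Rightarrow> complex \<Rightarrow> nat \<Rightarrow> nat \<Rightarrow> nat \<Rightarrow> (nat \<Rightarrow> int) \<Rightarrow> complex" where
  "lhs_term q h m r i s =
     h powi (2 * (\<Sum>j=1..r. (s j)\<^sup>2) + int m * (2 * (\<Sum>j=1..r-1. s j) + s r) - 2 * (\<Sum>j=1..i. s j))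
       * qpoch (- (h powi int m)) q (s r)
     / ((\<Prod>j=1..r-1. qpoch q q (s j - s (j + 1))) * qpoch (- (h powi (2 + int m))) q (s (r - 1)))
     * (-1) powi (s r) * qbinom q (int m + s r) (int m + 2 * s r)"

definition b_even :: "complex \<Rightarrow> int \<Rightarrow> int \<Rightarrow> int \<Rightarrow> complex" where
  "b_even q r i p =
     (1 + q powi p) / (2 * qpoch_inf q q) *
     (\<Sum>k=0..i. \<Sum>l=0..2*p.
        (-1) powi l * q powi (2*p*k + p*l) *
        qpoch_inf3 (q powi (2*r))
                   (q powi (2*p*r + r - i - p + 2*k + l))
                   (q powi (r + i - 2*p*r + p - 2*k - l))
                   (q powi (2*r)))"

definition b_odd :: "complex \<Rightarrow> complex \<Rightarrow> int \<Rightarrow> int \<Rightarrow> int \<Rightarrow> complex" where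
  "b_odd q h r i p =
     (-1) powi p * h powi (2*(1 - r)*p\<^sup>2 + (1 + 2*i - 2*r)*p) *
     ((1 + h powi (2*p + 1)) / (2 * qpoch_inf q q)) *
     (\<Sum>k=0..i. \<Sum>l=0..p.
        q powi (k + l) *
        (qpoch_inf3 (q powi (2*r))
                    (h powi (2*(2*r - i - p + 2*k + 2*l) - 1))
                    (h powi (2*(i + p - 2*k - 2*l) + 1))
                    (q powi (2*r))
         - h * qpoch_inf3 (q powi (2*r))
                    (h powi (2*(2*r - i - p + 2*k + 2*l) + 1))
                    (h powi (2*(i + p - 2*k - 2*l) - 1))
                    (q powi (2*r))))"

definition b_seq :: "complex \<Rightarrow> complex \<Rightarrow> nat \<Rightarrow> nat \<Rightarrow> nat \<Rightarrow> complex" where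
  "b_seq q h r i m =
     (if even m then b_even q (int r) (int i) (int (m div 2))
      else b_odd q h (int r) (int i) (int (m div 2)))"

end

theory Submission
  imports Defs
begin

text \<open>
  The sum over \<open>s r\<close> is a step of the Bailey lemma applied to the bilateral unit Bailey pair
  \<open>\<alpha>\<^sub>j = (-1)\<^sup>j q\<^bsup>j(j-1)/2\<^esup>\<close> relative to \<open>q\<^sup>m\<close>, whose \<open>\<beta>\<close> side is the q-binomial coefficient of
  the summand. The remaining \<open>r - 1\<close> sums act diagonally on the kernels
  \<open>1 / ((q)\<^bsub>n-j\<^esub> (q)\<^bsub>n+j+m\<^esub>)\<close>, except that each of the \<open>i\<close> sums carrying \<open>q\<^bsup>-s\<^esup>\<close> lengthens a geometric
  sum in \<open>q\<^bsup>2j+m\<^esup>\<close> by one term. Letting the outermost bound tend to infinity leaves a bilateral series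
  in \<open>j\<close> with denominators \<open>1 + q\<^bsup>j+m/2\<^esup>\<close>. Symmetrising it under \<open>j \<mapsto> -m-j\<close> turns the denominators
  into finite geometric sums (the sum over \<open>\<ell>\<close>), and Jacobi's triple product sums the resulting theta
  series. For odd \<open>m\<close> its quasi-periodicity brings the arguments into the stated range.
\<close>

section \<open>Reciprocal q-factorials and the Chu--Vandermonde sum\<close>

text \<open>The lower bound -floor(m/2) fits the symmetry j -> -m-j of the kernel: as the
  multipliers produced by each step are invariant too, only 2j + m >= 0 has to be treated. There the
  kernel vanishes for n < j, and j >= -floor(m/2), so the truncated sum over n is a complete
  Chu--Vandermonde sum.

  The parameters -q^(m/2) and -q^(1+m/2) are rho and aq/rho in the Bailey lemma relative to a = q^m,
  the second parameter being sent to infinity. Their quotient at j is (1 + q^(m/2)) / (1 +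
  q^(j+m/2)), the source of the denominators.

  The obstacle is the factor q^(-s): it destroys the diagonal action, because a correction q^(n+j+m)
  depending on the outer index n survives. It is carried through all i sums in closed form and
  disappears only in the limit. The outermost sum is given an extra factor 1/(q)_(M-s_1), which
  makes it a Bailey step like the others and tends to 1/(q)_infinity. Until then every sum is finite
  and the identity is exact for each M; analysis enters only through dominated convergence.\<close>

text \<open>The value 0 at negative \<open>k\<close> is that of \<open>1 / (q)\<^sub>k\<close>; it spares all boundary cases of the sums.\<close>

definition inv_qfac :: "complex \<Rightarrow> int \<Rightarrow> complex" where
  "inv_qfac q k = (if k < 0 then 0 else 1 / (\<Prod>j<nat k. 1 - q ^ Suc j))"

lemma inv_qfac_neg [simp]: "k < 0 \<Longrightarrow> inv_qfac q k = 0"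
  by (simp add: inv_qfac_def)

lemma inv_qfac_0 [simp]: "inv_qfac q 0 = 1"
  by (simp add: inv_qfac_def)

lemma power_Suc_neq_1:
  fixes q :: complex
  assumes "norm q < 1"
  shows "q ^ Suc n \<noteq> 1"
proof
  assume "q ^ Suc n = 1"
  then have "norm q ^ Suc n = 1" by (metis norm_one norm_power)
  moreover have "norm q ^ Suc n < 1" using assms by (metis norm_ge_zero power_0_Suc power_Suc_less_one order_le_less zero_less_one)
  ultimately show False by simp
qed

lemma inv_qfac_nonzero: "norm q < 1 \<Longrightarrow> 0 \<le> k \<Longrightarrow> inv_qfac q k \<noteq> 0"
  using power_Suc_neq_1[of q] by (auto simp: inv_qfac_def simp del: power_Suc)

lemma inv_qfac_step:
  assumes "norm q < 1"
  shows "(1 - q powi k) * inv_qfac q k = inv_qfac q (k - 1)"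
proof (cases "k \<le> 0")
  case True
  then show ?thesis by (cases "k = 0") auto
next
  case False
  then obtain n where k: "k = int (Suc n)" by (metis Suc_pred' int_eq_iff int_nat_eq less_eq_int_code(1) linorder_not_le nat_0_iff not_gr_zero zero_less_nat_eq)
  have "1 - q ^ Suc n \<noteq> 0" using power_Suc_neq_1[OF assms, of n] by simp
  then show ?thesis unfolding k power_int_of_nat
    by (simp add: inv_qfac_def nat_add_distrib del: power_Suc)
qed

lemma inv_qfac_add:
  assumes "norm q < 1" "0 \<le> c"
  shows "inv_qfac q (c + int n) = inv_qfac q c / (\<Prod>j<n. 1 - q powi c * q ^ Suc j)"
proof (induction n)
  case (Suc n)
  obtain d where d: "c = int d" using assms(2) nonneg_int_cases by blast
  have e: "q powi (c + int (Suc n)) = q powi c * q ^ Suc n"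
    unfolding d of_nat_add[symmetric] power_int_of_nat by (simp add: power_add)
  moreover have "1 - q powi (c + int (Suc n)) \<noteq> 0"
    using power_Suc_neq_1[OF assms(1), of "d + n"] unfolding d of_nat_add[symmetric] power_int_of_nat by simp
  ultimately have "inv_qfac q (c + int (Suc n)) = inv_qfac q (c + int n) / (1 - q powi c * q ^ Suc n)"
    using inv_qfac_step[OF assms(1), of "c + int (Suc n)"] by (simp add: field_simps)
  with Suc show ?case by simp
qed simp

text \<open>
  A homogeneous form of the q-Chu--Vandermonde sum: \<open>z = 0\<close> is its confluent limit and
  \<open>A = 0\<close> is the q-binomial theorem.
\<close>

lemma q_chu_vandermonde:
  assumes "norm q < 1" "\<And>j. A * q ^ Suc j \<noteq> 1"
  shows "(\<Sum>t\<le>N. (\<Prod>j<t. (z + A * q ^ j) * q ^ Suc j / (1 - A * q ^ Suc j))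
              * inv_qfac q (int t) * inv_qfac q (int N - int t))
         = (\<Prod>j<N. (1 + z * q ^ Suc j) / (1 - A * q ^ Suc j)) * inv_qfac q (int N)"
  using assms(2)
proof (induction N arbitrary: A)
  case 0
  show ?case by simp
next
  case (Suc N A)
  let ?R = "inv_qfac q"
  let ?P = "\<lambda>A t. \<Prod>j<t. (z + A * q ^ j) * q ^ Suc j / (1 - A * q ^ Suc j)"
  let ?Q = "\<lambda>A. \<Prod>j<N. (1 + z * q ^ Suc j) / (1 - A * q ^ Suc j)"
  have nz: "1 - A * q ^ Suc j \<noteq> 0" for j using Suc.prems[of j] by simp
  have IH1: "(\<Sum>t\<le>N. ?P A t * ?R (int t) * ?R (int N - int t)) = ?Q A * ?R (int N)"
    by (rule Suc.IH[OF Suc.prems])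
  have IH2: "(\<Sum>t\<le>N. ?P (A * q) t * ?R (int t) * ?R (int N - int t)) = ?Q (A * q) * ?R (int N)"
  proof (rule Suc.IH)
    show "A * q * q ^ Suc j \<noteq> 1" for j using Suc.prems[of "Suc j"] by (simp add: mult_ac)
  qed
  \<comment> \<open>The q-Pascal split 1 - q^(N+1) = (1 - q^(N+1-t)) + q^(N+1-t) (1 - q^t); each
    bracket lowers the index of one reciprocal factorial.\<close>
  have pascal: "(1 - q ^ Suc N) * (?R (int t) * ?R (int (Suc N) - int t))
      = ?R (int t) * ?R (int N - int t)
        + q ^ (Suc N - t) * (?R (int t - 1) * ?R (int (Suc N) - int t))" if "t \<le> Suc N" for t
  proof -
    define u where "u = Suc N - t"
    then have u: "Suc N = t + u" using that by simp
    have "int (Suc N) - int t = int u" "int N - int t = int u - 1" "Suc N - t = u"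
      using u by linarith+
    then have a: "?R (int N - int t) = (1 - q ^ (Suc N - t)) * ?R (int (Suc N) - int t)"
      using inv_qfac_step[OF assms(1), of "int u"] by (simp only: power_int_of_nat)
    have b: "?R (int t - 1) = (1 - q ^ t) * ?R (int t)"
      using inv_qfac_step[OF assms(1), of "int t"] by simp
    have c: "q ^ Suc N = q ^ (Suc N - t) * q ^ t" using that by (metis le_add_diff_inverse2 power_add)
    show ?thesis unfolding a b c by (simp add: algebra_simps)
  qed
  \<comment> \<open>Removing the first factor turns \<open>A\<close> into \<open>A * q\<close>. The
    second half of the Pascal split is therefore the induction hypothesis at \<open>A * q\<close>,
    and the induction has to generalise over \<open>A\<close>.\<close>
  have shift: "?P A (Suc t) = (z + A) * q / (1 - A * q) * q ^ t * ?P (A * q) t" for t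
  proof -
    have "?P A (Suc t) = (z + A) * q / (1 - A * q) *
        (\<Prod>j<t. (z + A * q ^ Suc j) * q ^ Suc (Suc j) / (1 - A * q ^ Suc (Suc j)))"
      by (subst prod.lessThan_Suc_shift) simp
    also have "(\<Prod>j<t. (z + A * q ^ Suc j) * q ^ Suc (Suc j) / (1 - A * q ^ Suc (Suc j)))
        = (\<Prod>j<t. q * ((z + A * q * q ^ j) * q ^ Suc j / (1 - A * q * q ^ Suc j)))"
      by (intro prod.cong refl) (simp add: mult_ac)
    also have "\<dots> = q ^ t * ?P (A * q) t" by (subst prod.distrib) simp
    finally show ?thesis by (simp only: mult.assoc)
  qed
  have "(1 - q ^ Suc N) * (\<Sum>t\<le>Suc N. ?P A t * ?R (int t) * ?R (int (Suc N) - int t))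
      = (\<Sum>t\<le>Suc N. ?P A t * ((1 - q ^ Suc N) * (?R (int t) * ?R (int (Suc N) - int t))))"
    by (simp add: sum_distrib_left mult_ac del: sum.atMost_Suc of_nat_Suc)
  also have "\<dots> = (\<Sum>t\<le>Suc N. ?P A t * (?R (int t) * ?R (int N - int t)
        + q ^ (Suc N - t) * (?R (int t - 1) * ?R (int (Suc N) - int t))))"
    by (intro sum.cong refl) (subst pascal, auto)
  also have "\<dots> = (\<Sum>t\<le>Suc N. ?P A t * ?R (int t) * ?R (int N - int t))
      + (\<Sum>t\<le>Suc N. ?P A t * q ^ (Suc N - t) * ?R (int t - 1) * ?R (int (Suc N) - int t))"
    by (simp add: sum.distrib ring_distribs mult.assoc del: sum.atMost_Suc of_nat_Suc)
  also have "(\<Sum>t\<le>Suc N. ?P A t * ?R (int t) * ?R (int N - int t)) = ?Q A * ?R (int N)"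
    using IH1 by simp
  also have "(\<Sum>t\<le>Suc N. ?P A t * q ^ (Suc N - t) * ?R (int t - 1) * ?R (int (Suc N) - int t))
      = (\<Sum>t\<le>N. ?P A (Suc t) * q ^ (N - t) * ?R (int t) * ?R (int N - int t))"
    by (subst sum.atMost_Suc_shift) simp
  also have "\<dots> = (\<Sum>t\<le>N. (z + A) * q / (1 - A * q) * q ^ N * (?P (A * q) t * ?R (int t) * ?R (int N - int t)))"
  proof (intro sum.cong refl)
    fix t assume "t \<in> {..N}"
    then have "q ^ N = q ^ t * q ^ (N - t)" by (metis atMost_iff le_add_diff_inverse power_add)
    then show "?P A (Suc t) * q ^ (N - t) * ?R (int t) * ?R (int N - int t)
      = (z + A) * q / (1 - A * q) * q ^ N * (?P (A * q) t * ?R (int t) * ?R (int N - int t))"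
      unfolding shift by (simp only: mult_ac)
  qed
  also have "\<dots> = (z + A) * q / (1 - A * q) * q ^ N * (?Q (A * q) * ?R (int N))"
    unfolding IH2[symmetric] by (simp add: sum_distrib_left)
  also have "(z + A) * q / (1 - A * q) * q ^ N * (?Q (A * q) * ?R (int N))
      = (z + A) * q ^ Suc N / (1 - A * q ^ Suc N) * ?Q A * ?R (int N)"
  proof -
    have "?Q (A * q) * (1 - A * q ^ Suc N) = ?Q A * (1 - A * q)"
    proof -
      have "(\<Prod>j<N. 1 - A * q * q ^ Suc j) * (1 - A * q) = (\<Prod>j<Suc N. 1 - A * q ^ Suc j)"
        by (subst prod.lessThan_Suc_shift) (simp add: mult_ac)
      also have "\<dots> = (\<Prod>j<N. 1 - A * q ^ Suc j) * (1 - A * q ^ Suc N)" by simp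
      finally have e: "(\<Prod>j<N. 1 - A * q * q ^ Suc j) * (1 - A * q) = (\<Prod>j<N. 1 - A * q ^ Suc j) * (1 - A * q ^ Suc N)" .
      have "(\<Prod>j<N. 1 - A * q * q ^ Suc j) \<noteq> 0" "(\<Prod>j<N. 1 - A * q ^ Suc j) \<noteq> 0"
        using nz nz[of "Suc j" for j] by (auto simp: mult_ac)
      moreover have "D' \<noteq> 0 \<Longrightarrow> D \<noteq> 0 \<Longrightarrow> D' * y = D * x \<Longrightarrow> a / D' * x = a / D * y"
        for D D' a x y :: complex
        by (simp add: divide_simps mult_ac)
      ultimately show ?thesis unfolding prod_dividef using e by blast
    qed
    moreover have d: "1 - A * q \<noteq> 0" using nz[of 0] by simp
    moreover have "w * q / d * x * (Q' * R) = w * (q * x) / d' * Q * R"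
      if "Q' * d' = Q * d" "d \<noteq> 0" "d' \<noteq> 0" for w x d d' Q Q' R :: complex
    proof -
      have "Q' = Q * d / d'" using that by (simp add: field_simps)
      then show ?thesis using that(2,3) by simp
    qed
    ultimately show ?thesis using nz[of N] unfolding power_Suc[of q N] by blast
  qed
  \<comment> \<open>The next factor appears because 1 - A q^(N+1) + (z + A) q^(N+1) = 1 + z
    q^(N+1).\<close>
  also have "?Q A * ?R (int N) + (z + A) * q ^ Suc N / (1 - A * q ^ Suc N) * ?Q A * ?R (int N)
      = (\<Prod>j<Suc N. (1 + z * q ^ Suc j) / (1 - A * q ^ Suc j)) * ?R (int N)"
    using nz[of N] by (simp add: divide_simps) (simp add: algebra_simps)
  also have "?R (int N) = (1 - q ^ Suc N) * ?R (int (Suc N))"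
    using inv_qfac_step[OF assms(1), of "int (Suc N)"] unfolding power_int_of_nat by simp
  finally show ?case using power_Suc_neq_1[OF assms(1), of N] by (simp del: sum.atMost_Suc of_nat_Suc prod.lessThan_Suc power_Suc)
qed

section \<open>Bailey kernels\<close>

lemma power_int_mult_same:
  fixes h :: complex
  assumes "h \<noteq> 0"
  shows "h powi a * h powi b = h powi (a + b)" "h powi a * (h powi b * x) = h powi (a + b) * x"
  using assms by (simp_all add: power_int_add)

text \<open>With a = q^m this is the Bailey matrix 1/((q)_(n-j) (aq)_(n+j)) divided by (q)_m. The
  normalisation makes it symmetric under j -> -m-j, and \<open>j\<close> may be any integer.\<close>

definition bailey_ker :: "complex \<Rightarrow> int \<Rightarrow> int \<Rightarrow> int \<Rightarrow> complex" where
  "bailey_ker q m j n = inv_qfac q (n - j) * inv_qfac q (n + j + m)"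

lemma bailey_ker_sym: "bailey_ker q m (- m - j) n = bailey_ker q m j n"
  by (simp add: bailey_ker_def algebra_simps)

lemma bailey_ker_eq_0: "j \<notin> {- m - n..n} \<Longrightarrow> bailey_ker q m j n = 0"
  by (auto simp: bailey_ker_def)

text \<open>The kernel vanishes for t < j, so any starting point a <= j gives the same sum. Putting
  t = j + u yields the shape of the Chu--Vandermonde sum with c = 2j + m.\<close>

lemma sum_bailey_ker_shift:
  assumes "a \<le> j"
  shows "(\<Sum>t=a..j + int N. f t * inv_qfac q (j + int N - t) * bailey_ker q m j t)
       = (\<Sum>u\<le>N. f (j + int u) * inv_qfac q (int N - int u) * inv_qfac q (int u) * inv_qfac q (2 * j + m + int u))"
proof -
  have "(\<Sum>t=a..j + int N. f t * inv_qfac q (j + int N - t) * bailey_ker q m j t)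
      = (\<Sum>t=j..j + int N. f t * inv_qfac q (j + int N - t) * bailey_ker q m j t)"
    using assms by (intro sum.mono_neutral_right) (auto simp: bailey_ker_def)
  also have "\<dots> = (\<Sum>u\<le>N. f (j + int u) * inv_qfac q (int N - int u) * bailey_ker q m j (j + int u))"
    by (rule sum.reindex_bij_witness[where i = "\<lambda>u. j + int u" and j = "\<lambda>t. nat (t - j)"])
      (auto simp: algebra_simps)
  finally show ?thesis by (simp add: bailey_ker_def mult_ac algebra_simps)
qed

lemma sum_below_bailey_ker:
  assumes "n < j"
  shows "(\<Sum>t=a..n. f t * inv_qfac q (n - t) * bailey_ker q m j t) = 0"
  using assms by (intro sum.neutral) (auto simp: bailey_ker_def)

lemma power_int_neq_1:
  fixes q :: complex
  assumes "norm q < 1" "0 \<le> c"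
  shows "q powi c * q ^ Suc j \<noteq> 1"
proof -
  obtain d where d: "c = int d" using assms(2) nonneg_int_cases by blast
  show ?thesis using power_Suc_neq_1[OF assms(1), of "d + j"] by (simp add: d power_add mult_ac)
qed

lemma prod_odd_powers: "(\<Prod>j<t. q ^ j * q ^ Suc j) = (q :: complex) ^ (t * t)"
proof (induction t)
  case (Suc t)
  have "q ^ (Suc t * Suc t) = q ^ (t * t) * (q ^ t * q ^ Suc t)"
    unfolding power_add[symmetric] by (rule arg_cong[where f = "power q"]) simp
  with Suc show ?case by (simp only: prod.lessThan_Suc)
qed simp

text \<open>The case z = 0, A = q^c of Chu--Vandermonde, divided by (q)_c. Combinatorially,
  partitions with parts at most N + c are sorted by their Durfee rectangle of u rows and u + c
  columns.\<close>

lemma sum_durfee: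
  assumes "norm q < 1" "0 \<le> c"
  shows "(\<Sum>u\<le>N. q ^ (u * u) * (q powi c) ^ u * inv_qfac q (int N - int u) * inv_qfac q (int u) * inv_qfac q (c + int u))
       = inv_qfac q (int N) * inv_qfac q (c + int N)"
proof -
  let ?A = "q powi c"
  have P: "(\<Prod>j<t. (0 + ?A * q ^ j) * q ^ Suc j / (1 - ?A * q ^ Suc j)) * inv_qfac q c
      = q ^ (t * t) * ?A ^ t * inv_qfac q (c + int t)" for t
  proof -
    have "(\<Prod>j<t. (0 + ?A * q ^ j) * q ^ Suc j) = (\<Prod>j<t. ?A * (q ^ j * q ^ Suc j))"
      by (simp add: mult_ac)
    also have "\<dots> = ?A ^ t * q ^ (t * t)" unfolding prod.distrib[of _ _ "{..<t}"] prod_odd_powers by simp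
    finally show ?thesis unfolding inv_qfac_add[OF assms] prod_dividef by simp
  qed
  have "(\<Sum>u\<le>N. q ^ (u * u) * ?A ^ u * inv_qfac q (int N - int u) * inv_qfac q (int u) * inv_qfac q (c + int u))
      = (\<Sum>u\<le>N. (\<Prod>j<u. (0 + ?A * q ^ j) * q ^ Suc j / (1 - ?A * q ^ Suc j))
          * inv_qfac q (int u) * inv_qfac q (int N - int u)) * inv_qfac q c"
    unfolding sum_distrib_right
  proof (intro sum.cong refl)
    fix u
    show "q ^ (u * u) * ?A ^ u * inv_qfac q (int N - int u) * inv_qfac q (int u) * inv_qfac q (c + int u)
        = (\<Prod>j<u. (0 + ?A * q ^ j) * q ^ Suc j / (1 - ?A * q ^ Suc j))
          * inv_qfac q (int u) * inv_qfac q (int N - int u) * inv_qfac q c"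
      using arg_cong[OF P[of u], of "\<lambda>x. x * (inv_qfac q (int u) * inv_qfac q (int N - int u))"]
      by (simp only: mult_ac)
  qed
  also have "\<dots> = inv_qfac q (int N) * inv_qfac q (c + int N)"
    using power_int_neq_1[OF assms]
    by (subst q_chu_vandermonde[OF assms(1)]) (simp_all add: inv_qfac_add[OF assms] prod_dividef)
  finally show ?thesis .
qed

text \<open>One of j and -m-j satisfies 2j + m >= 0, and this inequality forces j to be at least the
  lower summation bound -(m div 2).\<close>

lemma ker_symmetric_cases:
  fixes m j :: int
  assumes "\<And>j. 0 \<le> 2 * j + m \<Longrightarrow> - (m div 2) \<le> j \<Longrightarrow> P j" "\<And>j. P (- m - j) \<Longrightarrow> P j"
  shows "P j"
proof (cases "0 \<le> 2 * j + m")
  case True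
  then show ?thesis by (intro assms(1)) auto
next
  case False
  then show ?thesis by (intro assms(2)[of j] assms(1)) auto
qed

section \<open>Action of the quadratic weights on the Bailey kernel\<close>

locale half_nome =
  fixes h q :: complex
  assumes h0: "h \<noteq> 0" and norm_h: "norm h < 1" and q_def: "q = h\<^sup>2"
begin

lemma norm_q: "norm q < 1"
  using norm_h by (simp add: q_def norm_power power_less_one_iff)

lemma q_powi: "q powi x = h powi (2 * x)"
  by (simp add: q_def power_int_mult)

lemma q_pow: "q ^ n = h powi (2 * int n)"
  using q_powi[of "int n"] by simp

text \<open>Makes results of this locale available at the base q^(2r), with square root h^(2r); the
  theta series live there.\<close>

lemma half_nome_power: "0 < n \<Longrightarrow> half_nome (h ^ n) (q ^ n)"
  using h0 norm_h by unfold_locales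
    (auto simp: norm_power power_less_one_iff q_def power_mult[symmetric] mult.commute)

text \<open>Rewrites every monomial to a single power of \<open>h\<close>, so that an identity
  between monomials becomes a polynomial identity between integer exponents.\<close>

lemmas h_powi = q_powi q_pow power_int_mult_same[OF h0] power_int_power'

lemma sum_ker_square_aux:
  assumes "0 \<le> 2 * j + m" "a \<le> j"
  shows "(\<Sum>t=a..n. q powi (t\<^sup>2 + m * t) * inv_qfac q (n - t) * bailey_ker q m j t)
       = q powi (j\<^sup>2 + m * j) * bailey_ker q m j n"
proof (cases "n < j")
  case True
  then show ?thesis by (simp add: sum_below_bailey_ker bailey_ker_def)
next
  case False
  then obtain N where n: "n = j + int N" by (metis le_add_diff_inverse linorder_not_le nonneg_int_cases diff_ge_0_iff_ge)
  have "(\<Sum>t=a..n. q powi (t\<^sup>2 + m * t) * inv_qfac q (n - t) * bailey_ker q m j t)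
      = (\<Sum>u\<le>N. q powi ((j + int u)\<^sup>2 + m * (j + int u)) * inv_qfac q (int N - int u) * inv_qfac q (int u) * inv_qfac q (2 * j + m + int u))"
    unfolding n by (rule sum_bailey_ker_shift[OF assms(2)])
  also have "\<dots> = q powi (j\<^sup>2 + m * j) * (\<Sum>u\<le>N. q ^ (u * u) * (q powi (2 * j + m)) ^ u * inv_qfac q (int N - int u) * inv_qfac q (int u) * inv_qfac q (2 * j + m + int u))"
    unfolding sum_distrib_left
    by (intro sum.cong refl) (simp add: h_powi algebra_simps power2_eq_square)
  finally show ?thesis unfolding sum_durfee[OF norm_q assms(1)]
    by (simp add: bailey_ker_def n algebra_simps)
qed

text \<open>As a function of \<open>n\<close> the kernel is an eigenvector: this is the Bailey lemma
  with both parameters at infinity. The eigenvalue exponent j^2 + mj is invariant under j -> -m-j,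
  so the half 2j + m >= 0 suffices.\<close>

lemma sum_ker_square:
  "(\<Sum>t=- (m div 2)..n. q powi (t\<^sup>2 + m * t) * inv_qfac q (n - t) * bailey_ker q m j t)
       = q powi (j\<^sup>2 + m * j) * bailey_ker q m j n"
proof (induction j rule: ker_symmetric_cases[where m = m])
  case (1 j)
  then show ?case by (rule sum_ker_square_aux)
next
  case (2 j)
  then show ?case by (simp add: bailey_ker_sym algebra_simps power2_eq_square)
qed

lemma sum_ker_square_minus_aux:
  assumes "0 \<le> 2 * j + m" "a \<le> j"
  shows "(\<Sum>t=a..n. q powi (t\<^sup>2 + m * t - t) * inv_qfac q (n - t) * bailey_ker q m j t)
       = q powi (j\<^sup>2 + m * j - j) * (1 + q powi (2 * j + m) - q powi (n + j + m)) * bailey_ker q m j n"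
proof (cases "n < j")
  case True
  then show ?thesis by (simp add: sum_below_bailey_ker bailey_ker_def)
next
  case False
  then obtain N where n: "n = j + int N" by (metis le_add_diff_inverse linorder_not_le nonneg_int_cases diff_ge_0_iff_ge)
  define c where "c = 2 * j + m"
  have c: "0 \<le> c" using assms by (simp add: c_def)
  let ?R = "inv_qfac q"
  \<comment> \<open>From q^(-u) = 1 + q^(-u) (1 - q^u): the factor 1 - q^u lowers 1/(q)_u to
    1/(q)_(u-1), which leaves two sums of Durfee type.\<close>
  have split: "q powi ((j + int u)\<^sup>2 + m * (j + int u) - (j + int u)) * ?R (int N - int u) * ?R (int u) * ?R (c + int u)
     = q powi (j\<^sup>2 + m * j - j) * (q ^ (u * u) * (q powi c) ^ u * ?R (int N - int u) * ?R (int u) * ?R (c + int u)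
       + h powi (2 * (int u * int u + c * int u - int u)) * ?R (int N - int u) * ?R (int u - 1) * ?R (c + int u))" for u
  proof -
    have e: "?R (int u - 1) = (1 - q ^ u) * ?R (int u)"
      using inv_qfac_step[OF norm_q, of "int u"] by simp
    show ?thesis unfolding e
      by (simp add: h_powi c_def algebra_simps power2_eq_square)
  qed
  \<comment> \<open>After u = v + 1 this is the Durfee sum with c + 1 and N - 1 in place of c and N.
    For N = 0 both sides vanish, by the convention at negative indices.\<close>
  have second: "(\<Sum>u\<le>N. h powi (2 * (int u * int u + c * int u - int u)) * ?R (int N - int u) * ?R (int u - 1) * ?R (c + int u))
      = q powi c * (?R (int N - 1) * ?R (c + int N))"
  proof (cases N)
    case (Suc K)
    have "(\<Sum>u\<le>N. h powi (2 * (int u * int u + c * int u - int u)) * ?R (int N - int u) * ?R (int u - 1) * ?R (c + int u))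
       = (\<Sum>v\<le>K. q powi c * (q ^ (v * v) * (q powi (c + 1)) ^ v * ?R (int K - int v) * ?R (int v) * ?R (c + 1 + int v)))"
      unfolding Suc by (subst sum.atMost_Suc_shift) (simp add: h_powi mult.assoc, simp add: algebra_simps)
    also have "\<dots> = q powi c * (?R (int K) * ?R (c + 1 + int K))"
      using sum_durfee[OF norm_q, of "c + 1" K] c unfolding sum_distrib_left[symmetric] by simp
    finally show ?thesis by (simp add: Suc algebra_simps)
  qed simp
  have "(\<Sum>t=a..n. q powi (t\<^sup>2 + m * t - t) * ?R (n - t) * bailey_ker q m j t)
      = (\<Sum>u\<le>N. q powi ((j + int u)\<^sup>2 + m * (j + int u) - (j + int u)) * ?R (int N - int u) * ?R (int u) * ?R (c + int u))"
    unfolding n c_def by (rule sum_bailey_ker_shift[OF assms(2)])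
  also have "\<dots> = q powi (j\<^sup>2 + m * j - j) * (?R (int N) * ?R (c + int N) + q powi c * (?R (int N - 1) * ?R (c + int N)))"
    unfolding split sum_distrib_left[symmetric] sum.distrib second sum_durfee[OF norm_q c] ..
  also have "?R (int N - 1) = (1 - q ^ N) * ?R (int N)"
    using inv_qfac_step[OF norm_q, of "int N"] by simp
  finally have "(\<Sum>t=a..n. q powi (t\<^sup>2 + m * t - t) * ?R (n - t) * bailey_ker q m j t)
      = q powi (j\<^sup>2 + m * j - j) * (1 + q powi c - q powi c * q ^ N) * (?R (int N) * ?R (c + int N))"
    by (simp add: algebra_simps)
  moreover have "q powi c * q ^ N = q powi (n + j + m)" by (simp add: c_def n h_powi algebra_simps)
  moreover have "bailey_ker q m j n = ?R (int N) * ?R (c + int N)"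
    by (simp add: bailey_ker_def n c_def algebra_simps)
  ultimately show ?thesis by (simp add: c_def)
qed

text \<open>The multiplier equals q^(j^2+mj) (q^(-j) + q^(j+m) - q^(n+m)), which is visibly
  symmetric under j -> -m-j. It depends on \<open>n\<close>, so the kernel is no longer an
  eigenvector.\<close>

lemma sum_ker_square_minus:
  "(\<Sum>t=- (m div 2)..n. q powi (t\<^sup>2 + m * t - t) * inv_qfac q (n - t) * bailey_ker q m j t)
       = q powi (j\<^sup>2 + m * j - j) * (1 + q powi (2 * j + m) - q powi (n + j + m)) * bailey_ker q m j n"
proof (induction j rule: ker_symmetric_cases[where m = m])
  case (1 j)
  then show ?case by (rule sum_ker_square_minus_aux)
next
  case (2 j)
  then show ?case by (simp add: bailey_ker_sym h_powi algebra_simps power2_eq_square)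
qed

end

section \<open>Infinite q-products\<close>

lemma qpoch_inf_convergent:
  fixes y b :: complex
  assumes "norm b < 1"
  shows "convergent_prod (\<lambda>j. 1 - y * b ^ j)"
proof -
  have "summable (\<lambda>j. norm y * norm b ^ j)" using assms by (intro summable_mult summable_geometric) simp
  also have "(\<lambda>j. norm y * norm b ^ j) = (\<lambda>j. norm ((1 - y * b ^ j) - 1))"
    by (simp add: norm_mult norm_power)
  finally have "summable (\<lambda>j. norm ((1 - y * b ^ j) - 1))" .
  then show ?thesis
    unfolding abs_convergent_prod_conv_summable[symmetric] by (rule abs_convergent_prod_imp_convergent_prod)
qed

lemma qpoch_inf_LIMSEQ:
  assumes "norm b < 1"
  shows "(\<lambda>n. \<Prod>j<n. 1 - y * b ^ j) \<longlonglongrightarrow> qpoch_inf y b"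
proof -
  have "(\<lambda>n. \<Prod>j\<le>n. 1 - y * b ^ j) \<longlonglongrightarrow> qpoch_inf y b"
    unfolding qpoch_inf_def by (rule convergent_prod_LIMSEQ[OF qpoch_inf_convergent[OF assms]])
  then have "(\<lambda>n. \<Prod>j<Suc n. 1 - y * b ^ j) \<longlonglongrightarrow> qpoch_inf y b"
    by (simp only: lessThan_Suc_atMost)
  then show ?thesis by (rule LIMSEQ_imp_Suc)
qed

lemma qpoch_inf_split:
  assumes "norm b < 1"
  shows "qpoch_inf y b = (\<Prod>j<n. 1 - y * b ^ j) * qpoch_inf (y * b ^ n) b"
proof (rule LIMSEQ_unique)
  show "(\<lambda>k. \<Prod>j<k + n. 1 - y * b ^ j) \<longlonglongrightarrow> qpoch_inf y b"
    by (rule LIMSEQ_ignore_initial_segment[OF qpoch_inf_LIMSEQ[OF assms]])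
  have "(\<Prod>j<k + n. 1 - y * b ^ j) = (\<Prod>j<n. 1 - y * b ^ j) * (\<Prod>j<k. 1 - y * b ^ n * b ^ j)" for k
    by (induction k) (simp_all add: power_add mult_ac)
  then show "(\<lambda>k. \<Prod>j<k + n. 1 - y * b ^ j) \<longlonglongrightarrow> (\<Prod>j<n. 1 - y * b ^ j) * qpoch_inf (y * b ^ n) b"
    using tendsto_mult_left[OF qpoch_inf_LIMSEQ[OF assms]] by simp
qed

lemma qpoch_inf_nonzero:
  assumes "norm b < 1" "\<And>j. y * b ^ j \<noteq> 1"
  shows "qpoch_inf y b \<noteq> 0"
  unfolding qpoch_inf_def using assms(2)
  by (intro prodinf_nonzero[OF qpoch_inf_convergent[OF assms(1)]]) simp

text \<open>Each factor is at most 1 + |b|^j <= exp(|b|^j) in modulus, and the exponents form a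
  geometric series. The bound is uniform for \<open>y\<close> in the closed unit disc, as the later
  dominations require.\<close>

lemma norm_qpoch_inf_le:
  assumes "norm b < 1" "norm y \<le> 1"
  shows "norm (qpoch_inf y b) \<le> exp (1 / (1 - norm b))"
proof (rule LIMSEQ_le_const2)
  show "(\<lambda>n. norm (\<Prod>j<n. 1 - y * b ^ j)) \<longlonglongrightarrow> norm (qpoch_inf y b)"
    by (intro tendsto_norm qpoch_inf_LIMSEQ assms)
  have "norm (\<Prod>j<n. 1 - y * b ^ j) \<le> exp (1 / (1 - norm b))" for n
  proof -
    have "norm (\<Prod>j<n. 1 - y * b ^ j) \<le> (\<Prod>j<n. 1 + norm b ^ j)"
      unfolding prod_norm[symmetric]
    proof (intro prod_mono conjI norm_ge_zero)
      fix j
      have "norm (1 - y * b ^ j) \<le> 1 + norm y * norm b ^ j"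
        using norm_triangle_ineq4[of 1 "y * b ^ j"] by (simp add: norm_mult norm_power)
      also have "\<dots> \<le> 1 + 1 * norm b ^ j" using assms(2) by (intro add_left_mono mult_right_mono) auto
      finally show "norm (1 - y * b ^ j) \<le> 1 + norm b ^ j" by simp
    qed
    also have "\<dots> \<le> exp (\<Sum>j<n. norm b ^ j)" by (rule prod_le_exp_sum) simp
    also have "(\<Sum>j<n. norm b ^ j) \<le> (\<Sum>j. norm b ^ j)"
      using assms(1) by (intro sum_le_suminf summable_geometric) auto
    also have "\<dots> = 1 / (1 - norm b)" using assms(1) by (simp add: suminf_geometric)
    finally show ?thesis by simp
  qed
  then show "\<exists>N. \<forall>n\<ge>N. norm (\<Prod>j<n. 1 - y * b ^ j) \<le> exp (1 / (1 - norm b))" by blast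
qed

lemma qpoch_inf_self_nonzero: "norm q < 1 \<Longrightarrow> qpoch_inf q q \<noteq> 0"
  using power_Suc_neq_1[of q] by (intro qpoch_inf_nonzero) auto

lemma inv_qfac_eq:
  assumes "norm q < 1"
  shows "inv_qfac q (int n) = qpoch_inf (q * q ^ n) q / qpoch_inf q q"
proof -
  have "(\<Prod>j<n. 1 - q ^ Suc j) \<noteq> 0" using power_Suc_neq_1[OF assms] by (auto simp del: power_Suc)
  then show ?thesis using qpoch_inf_split[OF assms, of q n] qpoch_inf_self_nonzero[OF assms]
    by (simp add: inv_qfac_def divide_simps)
qed

lemma qpoch_self:
  assumes "norm q < 1" "0 \<le> k"
  shows "qpoch q q k = 1 / inv_qfac q k"
proof -
  obtain n where "k = int n" using assms(2) nonneg_int_cases by blast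
  then show ?thesis using inv_qfac_eq[OF assms(1), of n] by (simp add: qpoch_def)
qed

text \<open>The bound does not depend on \<open>k\<close>; it is the constant that dominates the
  reciprocal factorials in every limit below.\<close>

lemma norm_inv_qfac_le:
  assumes "norm q < 1"
  shows "norm (inv_qfac q k) \<le> exp (1 / (1 - norm q)) / norm (qpoch_inf q q)"
proof (cases "k < 0")
  case False
  then obtain n where k: "k = int n" by (metis linorder_not_less nonneg_int_cases)
  have "norm (q * q ^ n) \<le> 1"
    using assms by (simp add: norm_mult norm_power mult_le_one power_le_one)
  then show ?thesis unfolding k inv_qfac_eq[OF assms] norm_divide
    by (intro divide_right_mono norm_qpoch_inf_le assms) auto
qed simp

lemma inv_qfac_LIMSEQ:
  assumes "norm q < 1"
  shows "(\<lambda>n. inv_qfac q (int n)) \<longlonglongrightarrow> 1 / qpoch_inf q q"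
  unfolding inv_qfac_def using qpoch_inf_LIMSEQ[OF assms, of q] qpoch_inf_self_nonzero[OF assms]
  by (auto intro!: tendsto_intros)

lemma inv_qfac_LIMSEQ_shift:
  assumes "norm q < 1"
  shows "(\<lambda>n. inv_qfac q (int n + c)) \<longlonglongrightarrow> 1 / qpoch_inf q q"
proof -
  have "filterlim (\<lambda>n. nat (int n + c)) at_top at_top"
    unfolding filterlim_at_top
  proof
    fix Z
    show "eventually (\<lambda>n. Z \<le> nat (int n + c)) sequentially"
      using eventually_ge_at_top[of "Z + nat \<bar>c\<bar>"] by eventually_elim linarith
  qed
  then have "(\<lambda>n. inv_qfac q (int (nat (int n + c)))) \<longlonglongrightarrow> 1 / qpoch_inf q q"
    by (rule filterlim_compose[OF inv_qfac_LIMSEQ[OF assms]])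
  moreover have "eventually (\<lambda>n. inv_qfac q (int (nat (int n + c))) = inv_qfac q (int n + c)) sequentially"
    using eventually_ge_at_top[of "nat \<bar>c\<bar>"] by eventually_elim simp
  ultimately show ?thesis by (rule Lim_transform_eventually)
qed

section \<open>The Bailey step with parameter -q^(m/2)\<close>

context half_nome
begin

lemma neg_qpoch_inf_split: "qpoch_inf (- (h powi c)) q = (\<Prod>v<u. 1 + h powi (c + 2 * int v)) * qpoch_inf (- (h powi (c + 2 * int u))) q"
  using qpoch_inf_split[OF norm_q, of "- (h powi c)" u] by (simp add: h_powi)

lemma norm_h_powi_lt_1: "0 < c \<Longrightarrow> norm (h powi c) < 1"
  using norm_h h0 by (cases c rule: int_cases2) (auto simp: norm_power power_less_one_iff)

text \<open>A power of \<open>h\<close> with nonzero exponent does not have modulus 1, and at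
  exponent 0 the value is 2.\<close>

lemma one_plus_h_nonzero: "1 + h powi c \<noteq> 0"
proof
  assume a: "1 + h powi c = 0"
  then have c: "h powi c = -1" by (simp add: eq_neg_iff_add_eq_0 add.commute)
  have "c \<noteq> 0" using a by auto
  moreover have "\<not> 0 < c" using norm_h_powi_lt_1[of c] c by auto
  moreover have "\<not> 0 < - c" using norm_h_powi_lt_1[of "- c"] c by (auto simp: power_int_minus)
  ultimately show False by simp
qed

lemma neg_qpoch_inf_nonzero: "qpoch_inf (- (h powi c)) q \<noteq> 0"
proof (rule qpoch_inf_nonzero[OF norm_q])
  fix j
  show "- (h powi c) * q ^ j \<noteq> 1"
    using one_plus_h_nonzero[of "c + 2 * int j"] eq_neg_iff_add_eq_0[of 1 "h powi (c + 2 * int j)"]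
    by (auto simp: h_powi)
qed

text \<open>Chu--Vandermonde with A = q^c and z = q^(c/2): then z + A q^j = h^c (1 + h^(c+2j)), and
  1 + z q^(j+1) = 1 + h^(c+2+2j).\<close>

lemma sum_inner_aux:
  assumes "0 \<le> c"
  shows "(\<Sum>u\<le>N. h powi (int u * int u + int u + c * int u) * (\<Prod>v<u. 1 + h powi (c + 2 * int v))
            * inv_qfac q (int N - int u) * inv_qfac q (int u) * inv_qfac q (c + int u))
       = (\<Prod>v<N. 1 + h powi (c + 2 + 2 * int v)) * (inv_qfac q (int N) * inv_qfac q (c + int N))"
proof -
  let ?A = "q powi c" and ?z = "h powi c"
  have P: "(\<Prod>j<t. (?z + ?A * q ^ j) * q ^ Suc j / (1 - ?A * q ^ Suc j)) * inv_qfac q c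
      = h powi (int t * int t + int t + c * int t) * (\<Prod>v<t. 1 + h powi (c + 2 * int v)) * inv_qfac q (c + int t)" for t
  proof -
    have "(\<Prod>j<t. (?z + ?A * q ^ j) * q ^ Suc j)
        = h powi (int t * int t + int t + c * int t) * (\<Prod>v<t. 1 + h powi (c + 2 * int v))"
    proof (induction t)
      case (Suc t)
      then show ?case
        by (simp add: h_powi algebra_simps del: power_Suc)
    qed simp
    then show ?thesis unfolding inv_qfac_add[OF norm_q assms] prod_dividef by simp
  qed
  have "(\<Sum>u\<le>N. h powi (int u * int u + int u + c * int u) * (\<Prod>v<u. 1 + h powi (c + 2 * int v))
            * inv_qfac q (int N - int u) * inv_qfac q (int u) * inv_qfac q (c + int u))
      = (\<Sum>u\<le>N. (\<Prod>j<u. (?z + ?A * q ^ j) * q ^ Suc j / (1 - ?A * q ^ Suc j))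
          * inv_qfac q (int u) * inv_qfac q (int N - int u)) * inv_qfac q c"
    unfolding sum_distrib_right
  proof (intro sum.cong refl)
    fix u
    show "h powi (int u * int u + int u + c * int u) * (\<Prod>v<u. 1 + h powi (c + 2 * int v))
            * inv_qfac q (int N - int u) * inv_qfac q (int u) * inv_qfac q (c + int u)
        = (\<Prod>j<u. (?z + ?A * q ^ j) * q ^ Suc j / (1 - ?A * q ^ Suc j))
          * inv_qfac q (int u) * inv_qfac q (int N - int u) * inv_qfac q c"
      using arg_cong[OF P[of u], of "\<lambda>x. x * (inv_qfac q (int u) * inv_qfac q (int N - int u))"]
      by (simp only: mult_ac)
  qed
  also have "\<dots> = (\<Prod>v<N. 1 + h powi (c + 2 + 2 * int v)) * (inv_qfac q (int N) * inv_qfac q (c + int N))"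
    using power_int_neq_1[OF norm_q assms]
    by (subst q_chu_vandermonde[OF norm_q])
      (simp_all add: inv_qfac_add[OF norm_q assms] prod_dividef h_powi algebra_simps del: power_Suc)
  finally show ?thesis .
qed

text \<open>The quotient of infinite products is (-q^(m/2))_t / (-q^(1+m/2))_n without its constant
  factor 1 + q^(m/2). In this form negative \<open>t\<close> and \<open>n\<close> need no separate
  treatment.\<close>

lemma sum_ker_inner_aux:
  assumes "0 \<le> 2 * j + m" "a \<le> j"
  shows "(\<Sum>t=a..n. h powi (t\<^sup>2 + t + m * t) * (qpoch_inf (- (h powi (m + 2 + 2 * n))) q / qpoch_inf (- (h powi (m + 2 * t))) q) * inv_qfac q (n - t) * bailey_ker q m j t)
       = h powi (j\<^sup>2 + j + m * j) / (1 + h powi (m + 2 * j)) * bailey_ker q m j n"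
proof (cases "n < j")
  case True
  then show ?thesis by (simp add: sum_below_bailey_ker bailey_ker_def)
next
  case False
  then obtain N where n: "n = j + int N" by (metis le_add_diff_inverse linorder_not_le nonneg_int_cases diff_ge_0_iff_ge)
  define c where "c = 2 * j + m"
  have c: "0 \<le> c" using assms by (simp add: c_def)
  have m: "m = c - 2 * j" by (simp add: c_def)
  let ?R = "inv_qfac q"
  let ?PN = "\<Prod>v<N. 1 + h powi (c + 2 + 2 * int v)"
  have nz: "?PN \<noteq> 0" using one_plus_h_nonzero by auto
  \<comment> \<open>Both infinite products are compared with the one that starts at h^c. The factor
    \<open>1 + h powi c\<close>, independent of \<open>u\<close>, is the denominator that remains in
    the result.\<close>
  have E: "qpoch_inf (- (h powi (c + 2 + 2 * int N))) q / qpoch_inf (- (h powi (c + 2 * int u))) q = (\<Prod>v<u. 1 + h powi (c + 2 * int v)) / ((1 + h powi c) * ?PN)" for u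
  proof -
    have "(\<Prod>v<u. 1 + h powi (c + 2 * int v)) * qpoch_inf (- (h powi (c + 2 * int u))) q = (1 + h powi c) * qpoch_inf (- (h powi (c + 2))) q"
      using neg_qpoch_inf_split[of c u] neg_qpoch_inf_split[of c 1] by simp
    also have "qpoch_inf (- (h powi (c + 2))) q = ?PN * qpoch_inf (- (h powi (c + 2 + 2 * int N))) q" by (rule neg_qpoch_inf_split)
    finally show ?thesis using neg_qpoch_inf_nonzero nz one_plus_h_nonzero[of c] by (simp add: divide_simps mult_ac)
  qed
  have "(\<Sum>t=a..n. h powi (t\<^sup>2 + t + m * t) * (qpoch_inf (- (h powi (m + 2 + 2 * n))) q / qpoch_inf (- (h powi (m + 2 * t))) q) * ?R (n - t) * bailey_ker q m j t)
      = (\<Sum>u\<le>N. h powi ((j + int u)\<^sup>2 + (j + int u) + m * (j + int u)) * (qpoch_inf (- (h powi (m + 2 + 2 * n))) q / qpoch_inf (- (h powi (m + 2 * (j + int u)))) q) * ?R (int N - int u) * ?R (int u) * ?R (2 * j + m + int u))"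
    unfolding n by (rule sum_bailey_ker_shift[OF assms(2)])
  also have "\<dots> = h powi (j\<^sup>2 + j + m * j) / ((1 + h powi c) * ?PN) *
     (\<Sum>u\<le>N. h powi (int u * int u + int u + c * int u) * (\<Prod>v<u. 1 + h powi (c + 2 * int v))
            * ?R (int N - int u) * ?R (int u) * ?R (c + int u))"
    unfolding sum_distrib_left
  proof (intro sum.cong refl)
    fix u
    have e: "m + 2 + 2 * n = c + 2 + 2 * int N" "m + 2 * (j + int u) = c + 2 * int u" "2 * j + m + int u = c + int u"
      by (simp_all add: c_def n)
    have p: "h powi ((j + int u)\<^sup>2 + (j + int u) + m * (j + int u)) = h powi (j\<^sup>2 + j + m * j) * h powi (int u * int u + int u + c * int u)"
      by (simp add: h_powi c_def algebra_simps power2_eq_square)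
    show "h powi ((j + int u)\<^sup>2 + (j + int u) + m * (j + int u)) * (qpoch_inf (- (h powi (m + 2 + 2 * n))) q / qpoch_inf (- (h powi (m + 2 * (j + int u)))) q) * ?R (int N - int u) * ?R (int u) * ?R (2 * j + m + int u)
      = h powi (j\<^sup>2 + j + m * j) / ((1 + h powi c) * ?PN) * (h powi (int u * int u + int u + c * int u) * (\<Prod>v<u. 1 + h powi (c + 2 * int v))
            * ?R (int N - int u) * ?R (int u) * ?R (c + int u))"
      unfolding e E p by simp
  qed
  also have "\<dots> = h powi (j\<^sup>2 + j + m * j) / (1 + h powi c) * (?R (int N) * ?R (c + int N))"
    unfolding sum_inner_aux[OF c] using nz by simp
  finally show ?thesis by (simp add: bailey_ker_def n c_def add_ac)
qed

lemma sum_ker_inner: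
  "(\<Sum>t=- (m div 2)..n. h powi (t\<^sup>2 + t + m * t) * (qpoch_inf (- (h powi (m + 2 + 2 * n))) q / qpoch_inf (- (h powi (m + 2 * t))) q) * inv_qfac q (n - t) * bailey_ker q m j t)
       = h powi (j\<^sup>2 + j + m * j) / (1 + h powi (m + 2 * j)) * bailey_ker q m j n"
proof (induction j rule: ker_symmetric_cases[where m = m])
  case (1 j)
  then show ?case by (rule sum_ker_inner_aux)
next
  case (2 j)
  \<comment> \<open>Under j -> -m-j numerator and denominator are both multiplied by
    h^(-m-2j).\<close>
  have "h powi ((- m - j)\<^sup>2 + (- m - j) + m * (- m - j)) / (1 + h powi (m + 2 * (- m - j)))
      = h powi (j\<^sup>2 + j + m * j) / (1 + h powi (m + 2 * j))"
  proof -
    have "h powi ((- m - j)\<^sup>2 + (- m - j) + m * (- m - j)) * (1 + h powi (m + 2 * j))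
       = h powi (j\<^sup>2 + j + m * j) * (1 + h powi (m + 2 * (- m - j)))"
      by (simp add: h_powi algebra_simps power2_eq_square)
    then show ?thesis using one_plus_h_nonzero by (simp add: divide_simps)
  qed
  with 2 show ?case unfolding bailey_ker_sym by (simp only:)
qed

end

section \<open>Jacobi's triple product\<close>

lemma neg_one_powi: "(-1) powi k = (if even k then 1 else -1 :: complex)"
  by (cases k rule: int_cases2) (auto simp: power_int_minus minus_one_power_iff)

text \<open>For an absolutely summable family \<open>infsum\<close> is the integral against the
  counting measure, so Lebesgue's theorem applies. All three limits over infinite index sets are
  taken this way: the triple product, the multiple sum and the series in \<open>j\<close>.\<close>

lemma infsum_dominated_convergence:
  fixes f :: "nat \<Rightarrow> 'a \<Rightarrow> complex" and g :: "'a \<Rightarrow> real"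
  assumes lim: "\<And>x. x \<in> A \<Longrightarrow> (\<lambda>n. f n x) \<longlonglongrightarrow> F x"
    and le: "\<And>n x. x \<in> A \<Longrightarrow> norm (f n x) \<le> g x"
    and g: "g summable_on A"
  shows "(\<lambda>n. infsum (f n) A) \<longlonglongrightarrow> infsum F A"
proof -
  have gn: "norm (g x) = g x" if "x \<in> A" for x using order_trans[OF norm_ge_zero le[OF that, of 0]] by simp
  then have "(\<lambda>x. norm (g x)) summable_on A" using g by (simp cong: summable_on_cong)
  then have ig: "integrable (count_space A) g"
    unfolding abs_summable_equivalent Infinite_Set_Sum.abs_summable_on_def .
  note dom = integrable_dominated_convergence[where f = F and s = f and w = g and M = "count_space A"]
    integrable_dominated_convergence2[where f = F and s = f and w = g and M = "count_space A"]
    integral_dominated_convergence[where f = F and s = f and w = g and M = "count_space A"]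
  have iF: "integrable (count_space A) F"
    by (rule dom(1)) (use ig lim le in auto)
  have i_f: "integrable (count_space A) (f n)" for n
    by (rule dom(2)) (use ig lim le in auto)
  have l: "(\<lambda>n. integral\<^sup>L (count_space A) (f n)) \<longlonglongrightarrow> integral\<^sup>L (count_space A) F"
    by (rule dom(3)) (use ig lim le in auto)
  have *: "u summable_on A \<and> integral\<^sup>L (count_space A) u = infsum u A" if "integrable (count_space A) u" for u :: "'a \<Rightarrow> complex"
  proof -
    have a: "Infinite_Set_Sum.abs_summable_on u A" using that by (simp add: Infinite_Set_Sum.abs_summable_on_def)
    then have "(\<lambda>x. norm (u x)) summable_on A" by (simp only: abs_summable_equivalent)
    moreover have "infsetsum u A = infsum u A" by (rule infsetsum_infsum[OF a])
    ultimately show ?thesis by (simp add: infsetsum_def abs_summable_summable)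
  qed
  show "(\<lambda>n. infsum (f n) A) \<longlonglongrightarrow> infsum F A" using l *[OF iF] *[OF i_f] by simp
qed

text \<open>Root test: the n-th term is (x^n y)^n, and x^n y tends to 0.\<close>

lemma summable_gaussian_nat:
  fixes x y :: real
  assumes "0 < x" "x < 1" "0 < y"
  shows "summable (\<lambda>n. x ^ (n * n) * y ^ n)"
proof -
  have "(\<lambda>n. x ^ n * y) \<longlonglongrightarrow> 0 * y"
    by (intro tendsto_mult_right LIMSEQ_realpow_zero) (use assms in auto)
  then have "eventually (\<lambda>n. x ^ n * y < 1 / 2) sequentially"
    by (intro order_tendstoD) auto
  then have "eventually (\<lambda>n. norm (x ^ (n * n) * y ^ n) \<le> (1 / 2) ^ n) sequentially"
  proof eventually_elim
    case (elim n)
    have "norm (x ^ (n * n) * y ^ n) = (x ^ n * y) ^ n"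
      using assms by (simp add: power_mult power_mult_distrib)
    also have "\<dots> \<le> (1 / 2) ^ n" using elim assms by (intro power_mono) auto
    finally show ?case .
  qed
  then show ?thesis by (rule summable_comparison_test_ev) (simp add: summable_geometric)
qed

lemma summable_on_gaussian:
  fixes x y :: real
  assumes "0 < x" "x < 1" "0 < y"
  shows "(\<lambda>j::int. x powi (j * j) * y powi j) summable_on UNIV"
proof -
  let ?f = "\<lambda>j::int. x powi (j * j) * y powi j"
  have nat: "(\<lambda>n. x ^ (n * n) * w ^ n) summable_on UNIV" if "0 < w" for w
    using summable_gaussian_nat[of x w] assms that by (simp add: summable_on_UNIV_nonneg_real_iff)
  have "(?f \<circ> int) summable_on UNIV"
  proof -
    have "?f \<circ> int = (\<lambda>n. x ^ (n * n) * y ^ n)" by (auto simp: fun_eq_iff simp flip: of_nat_mult)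
    then show ?thesis using nat[of y] assms by simp
  qed
  then have 1: "?f summable_on range int"
    by (subst summable_on_reindex) auto
  have "(?f \<circ> (\<lambda>n. - int n)) summable_on UNIV"
  proof -
    have "?f \<circ> (\<lambda>n. - int n) = (\<lambda>n. x ^ (n * n) * (1 / y) ^ n)"
      by (auto simp: fun_eq_iff power_int_minus inverse_eq_divide power_one_over simp flip: of_nat_mult)
    then show ?thesis using nat[of "1 / y"] assms by simp
  qed
  then have 2: "?f summable_on range (\<lambda>n. - int n)"
    by (subst summable_on_reindex) (auto simp: inj_on_def)
  have "UNIV = range int \<union> range (\<lambda>n. - int n)"
    by (auto intro: int_cases2)
  then show ?thesis using summable_on_union[OF 1 2] by simp
qed

section \<open>The finite triple product, the unit Bailey pair and Jacobi's identity\<close>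

context half_nome
begin

lemma summable_on_norm_h_quadratic:
  assumes "0 < a" "z \<noteq> 0"
  shows "(\<lambda>j::int. norm (h powi (a * j\<^sup>2 + b * j + d) * z powi j)) summable_on UNIV"
proof -
  let ?x = "norm h powi a" and ?y = "norm h powi b * norm z"
  have "(\<lambda>j::int. norm (h powi d) * (?x powi (j * j) * ?y powi j)) summable_on UNIV"
  proof (intro summable_on_cmult_right summable_on_gaussian)
    have "0 < nat a" using assms by simp
    moreover have "?x = norm h ^ nat a" using assms by (simp add: power_int_nonneg_exp)
    ultimately show "?x < 1" using norm_h by (simp add: power_less_one_iff)
  qed (use h0 assms in auto)
  also have "(\<lambda>j::int. norm (h powi d) * (?x powi (j * j) * ?y powi j)) = (\<lambda>j::int. norm (h powi (a * j\<^sup>2 + b * j + d) * z powi j))"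
  proof
    fix j
    have "h powi (a * j\<^sup>2 + b * j + d) = (h powi a) powi (j * j) * (h powi b) powi j * h powi d"
      by (simp add: h_powi power_int_mult[symmetric] power2_eq_square)
    then show "norm (h powi d) * (?x powi (j * j) * ?y powi j) = norm (h powi (a * j\<^sup>2 + b * j + d) * z powi j)"
      by (simp add: norm_mult norm_power_int power_int_mult_distrib mult_ac)
  qed
  finally show ?thesis .
qed

text \<open>With l = n - j this is the q-binomial theorem, the case A = 0 of Chu--Vandermonde. It is
  a finite triple product and serves twice: z = 1 gives the unit Bailey pair, and m = 0 with n
  tending to infinity gives Jacobi's identity.\<close>

lemma sum_ker_gauss:
  assumes "z \<noteq> 0" "2 * n + m = int K"
  shows "(\<Sum>j=- m - n..n. (-1) powi j * h powi (j\<^sup>2 - j) * z powi j * bailey_ker q m j n)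
    = (-1) powi n * h powi (n\<^sup>2 - n) * z powi n * inv_qfac q (int K) * (\<Prod>t<K. 1 - h powi (2 - 2 * n + 2 * int t) / z)"
proof -
  let ?R = "inv_qfac q"
  let ?x = "h powi (- 2 * n) / z"
  have m: "m = int K - 2 * n" using assms by simp
  have "(\<Sum>j=- m - n..n. (-1) powi j * h powi (j\<^sup>2 - j) * z powi j * bailey_ker q m j n)
     = (\<Sum>l\<le>K. (-1) powi (n - int l) * h powi ((n - int l)\<^sup>2 - (n - int l)) * z powi (n - int l) * bailey_ker q m (n - int l) n)"
    by (rule sum.reindex_bij_witness[where i = "\<lambda>l. n - int l" and j = "\<lambda>j. nat (n - j)"]) (use assms in auto)
  also have "\<dots> = (\<Sum>l\<le>K. (-1) powi n * h powi (n\<^sup>2 - n) * z powi n *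
       ((\<Prod>j<l. (- ?x + 0 * q ^ j) * q ^ Suc j / (1 - 0 * q ^ Suc j)) * ?R (int l) * ?R (int K - int l)))"
  proof (intro sum.cong refl)
    fix l
    have P: "(\<Prod>j<l. (- ?x + 0 * q ^ j) * q ^ Suc j / (1 - 0 * q ^ Suc j)) = (-1) powi (int l) * h powi (int l * int l + int l - 2 * n * int l) * z powi (- int l)"
    proof (induction l)
      case (Suc l)
      have "(- ?x + 0 * q ^ l) * q ^ Suc l / (1 - 0 * q ^ Suc l) = (-1) * h powi (2 * int l + 2 - 2 * n) * z powi (- 1)"
        using power_int_minus[of z 1] by (simp add: h_powi divide_inverse algebra_simps del: power_Suc)
      moreover have "h powi (int (Suc l) * int (Suc l) + int (Suc l) - 2 * n * int (Suc l))
          = h powi (int l * int l + int l - 2 * n * int l) * h powi (2 * int l + 2 - 2 * n)"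
        by (simp add: h_powi algebra_simps)
      moreover have "z powi (- int (Suc l)) = z powi (- int l) * z powi (- 1)"
        using power_int_add[of z "- int l" "- 1"] assms(1) by (simp add: add.commute)
      moreover have "(-1) powi int (Suc l) = (-1) powi int l * (-1 :: complex)" by (simp add: neg_one_powi)
      ultimately show ?case unfolding prod.lessThan_Suc Suc by (simp only: mult_ac)
    qed simp
    have 1: "(-1) powi (n - int l) = (-1) powi n * ((-1) powi (int l) :: complex)"
      by (simp add: neg_one_powi)
    have 2: "h powi ((n - int l)\<^sup>2 - (n - int l)) = h powi (n\<^sup>2 - n) * h powi (int l * int l + int l - 2 * n * int l)"
      by (simp add: h_powi algebra_simps power2_eq_square)
    have 3: "z powi (n - int l) = z powi n * z powi (- int l)"
      using assms(1) by (simp add: power_int_add[symmetric])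
    have 4: "bailey_ker q m (n - int l) n = ?R (int l) * ?R (int K - int l)"
      by (simp add: bailey_ker_def m)
    show "(-1) powi (n - int l) * h powi ((n - int l)\<^sup>2 - (n - int l)) * z powi (n - int l) * bailey_ker q m (n - int l) n
      = (-1) powi n * h powi (n\<^sup>2 - n) * z powi n *
       ((\<Prod>j<l. (- ?x + 0 * q ^ j) * q ^ Suc j / (1 - 0 * q ^ Suc j)) * ?R (int l) * ?R (int K - int l))"
      unfolding P 1 2 3 4 by (simp only: mult_ac)
  qed
  also have "\<dots> = (-1) powi n * h powi (n\<^sup>2 - n) * z powi n * ((\<Prod>j<K. (1 + (- ?x) * q ^ Suc j) / (1 - 0 * q ^ Suc j)) * ?R (int K))"
    unfolding sum_distrib_left[symmetric] by (subst q_chu_vandermonde[OF norm_q]) auto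
  also have "(\<Prod>j<K. (1 + (- ?x) * q ^ Suc j) / (1 - 0 * q ^ Suc j)) = (\<Prod>t<K. 1 - h powi (2 - 2 * n + 2 * int t) / z)"
    by (intro prod.cong refl) (simp add: h_powi algebra_simps del: power_Suc)
  finally show ?thesis by (simp only: mult_ac)
qed

text \<open>At z = 1 the finite product is that of 1 - q^(1-n+t) over t < K. For n = -d <= 0 it
  equals (q)_(d+K) / (q)_d with d + K = m + n, which is what the q-binomial needs. Any finite
  \<open>F\<close> containing the support is allowed, so that one range can serve several values of
  \<open>n\<close>.\<close>

lemma unit_bailey_pair:
  assumes "0 \<le> 2 * n + m" "0 \<le> m" "finite F" "{- m - n..n} \<subseteq> F"
  shows "(\<Sum>j\<in>F. (-1) powi j * h powi (j\<^sup>2 - j) * bailey_ker q m j n)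
     = (-1) powi n * h powi (n\<^sup>2 - n) * qbinom q (m + n) (m + 2 * n)"
proof -
  obtain K where K: "2 * n + m = int K" using assms(1) nonneg_int_cases by blast
  have "(\<Sum>j\<in>F. (-1) powi j * h powi (j\<^sup>2 - j) * bailey_ker q m j n) = (\<Sum>j=- m - n..n. (-1) powi j * h powi (j\<^sup>2 - j) * 1 powi j * bailey_ker q m j n)"
    using assms(3,4) bailey_ker_eq_0[of _ m n q] by (intro sum.mono_neutral_cong_right) auto
  also have "\<dots> = (-1) powi n * h powi (n\<^sup>2 - n) * (inv_qfac q (int K) * (\<Prod>t<K. 1 - h powi (2 - 2 * n + 2 * int t)))"
    by (subst sum_ker_gauss[OF _ K]) auto
  also have "inv_qfac q (int K) * (\<Prod>t<K. 1 - h powi (2 - 2 * n + 2 * int t)) = qbinom q (m + n) (m + 2 * n)"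
  proof (cases "n \<le> 0")
    case True
    obtain d where d: "- n = int d" using True by (metis neg_0_le_iff_le nonneg_int_cases)
    have mn: "m + n = int d + int K" using K d by simp
    have "inv_qfac q (int d + int K) = inv_qfac q (int d) / (\<Prod>j<K. 1 - q powi int d * q ^ Suc j)"
      by (rule inv_qfac_add[OF norm_q]) simp
    also have "(\<Prod>j<K. 1 - q powi int d * q ^ Suc j) = (\<Prod>t<K. 1 - h powi (2 - 2 * n + 2 * int t))"
    proof (intro prod.cong refl)
      fix j
      have "n = - int d" using d by simp
      then show "1 - q powi int d * q ^ Suc j = 1 - h powi (2 - 2 * n + 2 * int j)"
        by (simp add: h_powi algebra_simps del: power_Suc)
    qed
    finally have "inv_qfac q (int d + int K) * (\<Prod>t<K. 1 - h powi (2 - 2 * n + 2 * int t)) = inv_qfac q (int d)"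
      using inv_qfac_nonzero[OF norm_q, of "int d + int K"] inv_qfac_nonzero[OF norm_q, of "int d"] by (auto simp: field_simps)
    then have "(\<Prod>t<K. 1 - h powi (2 - 2 * n + 2 * int t)) = inv_qfac q (int d) / inv_qfac q (int d + int K)"
      using inv_qfac_nonzero[OF norm_q, of "int d + int K"] by (simp add: field_simps)
    moreover have "qbinom q (m + n) (m + 2 * n) = inv_qfac q (int K) * inv_qfac q (int d) / inv_qfac q (int d + int K)"
    proof -
      have "m + 2 * n = int K" using K by simp
      then show ?thesis unfolding mn by (simp add: qbinom_def qpoch_self[OF norm_q])
    qed
    ultimately show ?thesis by simp
  next
    case False
    \<comment> \<open>For n > 0 the factor at t = n - 1 is 1 - q^0, while the q-binomial vanishes
      since m + 2n > m + n.\<close>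
    then have "nat (n - 1) \<in> {..<K}" "1 - h powi (2 - 2 * n + 2 * int (nat (n - 1))) = 0" using K assms(2) by auto
    then have "(\<Prod>t<K. 1 - h powi (2 - 2 * n + 2 * int t)) = 0" by (metis finite_lessThan prod_zero)
    then show ?thesis using False by (simp add: qbinom_def)
  qed
  finally show ?thesis .
qed

lemma jacobi_triple_product:
  assumes "z \<noteq> 0"
  shows "((\<lambda>j. (-1) powi j * h powi (j\<^sup>2 - j) * z powi j) has_sum
      qpoch_inf3 q z (q / z) q) UNIV"
proof -
  let ?R = "inv_qfac q"
  let ?f = "\<lambda>j. (-1) powi j * h powi (j\<^sup>2 - j) * z powi j"
  let ?P = "qpoch_inf q q"
  define C where "C = exp (1 / (1 - norm q)) / norm ?P"
  have nz: "?P \<noteq> 0" by (rule qpoch_inf_self_nonzero[OF norm_q])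
  have n1: "norm (?f j) = norm (h powi (1 * j\<^sup>2 + (-1) * j + 0) * z powi j)" for j
    by (simp add: norm_mult norm_power_int)
  have abs: "(\<lambda>j. norm (?f j)) summable_on UNIV"
    unfolding n1 by (rule summable_on_norm_h_quadratic) (use assms in auto)
  have lim: "(\<lambda>N. ?f j * bailey_ker q 0 j (int N)) \<longlonglongrightarrow> ?f j * (1 / ?P * (1 / ?P))" for j
    unfolding bailey_ker_def using inv_qfac_LIMSEQ_shift[OF norm_q, of "- j"] inv_qfac_LIMSEQ_shift[OF norm_q, of "j"]
    by (intro tendsto_mult_left tendsto_mult) simp_all
  have le: "norm (?f j * bailey_ker q 0 j (int N)) \<le> norm (?f j) * (C * C)" for j N
    unfolding norm_mult[of "?f j"] bailey_ker_def norm_mult[of "?R _"] C_def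
    by (intro mult_left_mono mult_mono norm_inv_qfac_le[OF norm_q]) auto
  have fin: "infsum (\<lambda>j. ?f j * bailey_ker q 0 j (int N)) UNIV
      = ?R (int (2 * N)) * ((\<Prod>u<N. 1 - z * q ^ u) * (\<Prod>u<N. 1 - q / z * q ^ u))" for N
  proof -
    have "infsum (\<lambda>j. ?f j * bailey_ker q 0 j (int N)) UNIV = infsum (\<lambda>j. ?f j * bailey_ker q 0 j (int N)) {- 0 - int N..int N}"
      using bailey_ker_eq_0[of _ 0 "int N" q] by (intro infsum_cong_neutral) auto
    also have "\<dots> = (-1) powi int N * h powi ((int N)\<^sup>2 - int N) * z powi int N * ?R (int (2 * N)) * (\<Prod>t<2 * N. 1 - h powi (2 - 2 * int N + 2 * int t) / z)"
      by (subst infsum_finite, simp, rule sum_ker_gauss[OF assms]) simp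
    \<comment> \<open>The upper half of the 2N factors is already (q/z)_N. The lower half has
      negative powers of q and becomes (z)_N once the monomial prefactor is absorbed.\<close>
    also have "(\<Prod>t<2 * N. 1 - h powi (2 - 2 * int N + 2 * int t) / z)
       = (\<Prod>t<N. 1 - h powi (2 - 2 * int N + 2 * int t) / z) * (\<Prod>u<N. 1 - q / z * q ^ u)"
    proof -
      have "(\<Prod>t<N + k. 1 - h powi (2 - 2 * int N + 2 * int t) / z)
         = (\<Prod>t<N. 1 - h powi (2 - 2 * int N + 2 * int t) / z) * (\<Prod>u<k. 1 - q * q ^ u / z)" for k
      proof (induction k)
        case (Suc k)
        have "h powi (2 - 2 * int N + 2 * int (N + k)) = q * q ^ k"
          using h_powi(2)[of "Suc k"] by (simp add: algebra_simps)
        with Suc show ?case by simp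
      qed simp
      from this[of N] show ?thesis unfolding mult_2[of N, symmetric] by (simp only: times_divide_eq_left)
    qed
    also have "(\<Prod>t<N. 1 - h powi (2 - 2 * int N + 2 * int t) / z) = (\<Prod>u<N. 1 - h powi (- 2 * int u) / z)"
      by (rule prod.reindex_bij_witness[of _ "\<lambda>u. N - Suc u" "\<lambda>u. N - Suc u"])
        (auto simp: of_nat_diff algebra_simps)
    finally have e: "infsum (\<lambda>j. ?f j * bailey_ker q 0 j (int N)) UNIV =
      ((-1) powi int N * h powi ((int N)\<^sup>2 - int N) * z powi int N * (\<Prod>u<N. 1 - h powi (- 2 * int u) / z)) * ?R (int (2 * N)) * (\<Prod>u<N. 1 - q / z * q ^ u)"
      by (simp only: mult_ac)
    \<comment> \<open>Factor by factor: 1 - z q^u = -z q^u (1 - q^(-u)/z).\<close>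
    have "(-1) powi int N * h powi ((int N)\<^sup>2 - int N) * z powi int N * (\<Prod>u<N. 1 - h powi (- 2 * int u) / z) = (\<Prod>u<N. 1 - z * q ^ u)"
    proof (induction N)
      case (Suc N)
      have "(1 - z * q ^ N) = (-1) * (h powi (2 * int N) * z * (1 - h powi (- 2 * int N) / z))"
        using assms by (simp add: h_powi algebra_simps)
      moreover have "h powi ((int (Suc N))\<^sup>2 - int (Suc N)) = h powi ((int N)\<^sup>2 - int N) * h powi (2 * int N)"
        by (simp add: h_powi algebra_simps power2_eq_square)
      moreover have "z powi int (Suc N) = z powi int N * z" "(-1) powi int (Suc N) = (-1) powi int N * (-1 :: complex)"
        unfolding power_int_of_nat by simp_all
      ultimately show ?case unfolding prod.lessThan_Suc Suc[symmetric] by (simp only: mult_ac)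
    qed simp
    then show ?thesis unfolding e by (simp only: mult_ac)
  qed
  \<comment> \<open>The kernel tends to 1/(q)_infinity^2 and the prefactor on the product side to
    1/(q)_infinity; the surplus is the entry \<open>q\<close> of \<open>qpoch_inf3\<close>.\<close>
  have "(\<lambda>N. infsum (\<lambda>j. ?f j * bailey_ker q 0 j (int N)) UNIV) \<longlonglongrightarrow> infsum (\<lambda>j. ?f j * (1 / ?P * (1 / ?P))) UNIV"
    by (rule infsum_dominated_convergence[OF lim le summable_on_cmult_left[OF abs]])
  moreover have "(\<lambda>N. infsum (\<lambda>j. ?f j * bailey_ker q 0 j (int N)) UNIV) \<longlonglongrightarrow> 1 / ?P * (qpoch_inf z q * qpoch_inf (q / z) q)"
    unfolding fin
  proof (intro tendsto_mult qpoch_inf_LIMSEQ[OF norm_q])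
    show "(\<lambda>N. ?R (int (2 * N))) \<longlonglongrightarrow> 1 / ?P"
      by (rule filterlim_compose[OF inv_qfac_LIMSEQ[OF norm_q]]) (rule mult_nat_left_at_top, simp)
  qed
  ultimately have "infsum (\<lambda>j. ?f j * (1 / ?P * (1 / ?P))) UNIV = 1 / ?P * (qpoch_inf z q * qpoch_inf (q / z) q)"
    by (rule LIMSEQ_unique)
  then have "infsum ?f UNIV = qpoch_inf3 q z (q / z) q"
    unfolding infsum_cmult_left' qpoch_inf3_def using nz by (simp add: field_simps)
  then show ?thesis using has_sum_infsum[OF abs_summable_summable[OF abs]] by (simp only:)
qed

end

section \<open>Sums over chains\<close>

text \<open>The upper bound \<open>M\<close> of a tuple \<open>s\<close> is treated as an entry at position 0.\<close>

definition entry :: "int \<Rightarrow> (nat \<Rightarrow> int) \<Rightarrow> nat \<Rightarrow> int" where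
  "entry M s k = (if k = 0 then M else s k)"

definition chains :: "int \<Rightarrow> int \<Rightarrow> nat \<Rightarrow> (nat \<Rightarrow> int) set" where
  "chains a M k = {s \<in> {1..k} \<rightarrow>\<^sub>E UNIV. \<forall>j\<in>{1..k}. a \<le> s j \<and> s j \<le> entry M s (j - 1)}"

lemma chains_le:
  assumes "s \<in> chains a M k" "j \<in> {1..k}"
  shows "s j \<le> M"
  using assms(2)
proof (induction j)
  case (Suc j)
  then have "s (Suc j) \<le> entry M s (Suc j - 1)" using assms(1) unfolding chains_def by blast
  with Suc show ?case by (cases "j = 0") (auto simp: entry_def)
qed simp

lemma finite_chains: "finite (chains a M k)"
proof (rule finite_subset)
  show "chains a M k \<subseteq> {1..k} \<rightarrow>\<^sub>E {a..M}"
  proof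
    fix s assume s: "s \<in> chains a M k"
    then show "s \<in> {1..k} \<rightarrow>\<^sub>E {a..M}"
      using chains_le[OF s] unfolding chains_def by (auto simp: PiE_iff)
  qed
qed (simp add: finite_PiE)

lemma chains_0: "chains a M 0 = {\<lambda>_. undefined}"
  by (auto simp: chains_def)

text \<open>The last and smallest entry is split off, so that a multiple sum can be evaluated from
  the inside.\<close>

lemma sum_chains_Suc:
  "(\<Sum>s\<in>chains a M (Suc k). f s) = (\<Sum>s\<in>chains a M k. \<Sum>t=a..entry M s k. f (s(Suc k := t)))"
proof -
  have "(\<Sum>s\<in>chains a M k. \<Sum>t=a..entry M s k. f (s(Suc k := t)))
      = (\<Sum>(s, t)\<in>Sigma (chains a M k) (\<lambda>s. {a..entry M s k}). f (s(Suc k := t)))"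
    by (rule sum.Sigma) (auto simp: finite_chains)
  also have "\<dots> = (\<Sum>s\<in>chains a M (Suc k). f s)"
  proof (rule sum.reindex_bij_witness[where i = "\<lambda>s. (restrict s {1..k}, s (Suc k))" and j = "\<lambda>(s, t). s(Suc k := t)"])
    fix p assume "p \<in> Sigma (chains a M k) (\<lambda>s. {a..entry M s k})"
    then obtain s t where p: "p = (s, t)" and s: "s \<in> chains a M k" and t: "a \<le> t" "t \<le> entry M s k" by auto
    have undef: "s x = undefined" if "x \<notin> {1..k}" for x
      using s that by (auto simp: chains_def PiE_iff extensional_def)
    show "(\<lambda>s. (restrict s {1..k}, s (Suc k))) ((\<lambda>(s, t). s(Suc k := t)) p) = p"
      using undef by (auto simp: p fun_eq_iff restrict_def)
    have e: "entry M (s(Suc k := t)) j = entry M s j" if "j \<le> k" for j using that by (auto simp: entry_def)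
    have "a \<le> (s(Suc k := t)) j \<and> (s(Suc k := t)) j \<le> entry M (s(Suc k := t)) (j - 1)" if "j \<in> {1..Suc k}" for j
    proof (cases "j = Suc k")
      case True
      then show ?thesis using t e[of k] by simp
    next
      case False
      then show ?thesis using that s e[of "j - 1"] by (auto simp: chains_def)
    qed
    moreover have "s(Suc k := t) \<in> {1..Suc k} \<rightarrow>\<^sub>E UNIV"
      using undef by (auto simp: PiE_iff extensional_def)
    ultimately show "(\<lambda>(s, t). s(Suc k := t)) p \<in> chains a M (Suc k)"
      unfolding p chains_def by auto
    show "f ((\<lambda>(s, t). s(Suc k := t)) p) = (\<lambda>(s, t). f (s(Suc k := t))) p" by (simp add: p)
  next
    fix s assume s: "s \<in> chains a M (Suc k)"
    have undef: "s x = undefined" if "x \<notin> {1..Suc k}" for x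
      using s that by (auto simp: chains_def PiE_iff extensional_def)
    show "(\<lambda>(s, t). s(Suc k := t)) (restrict s {1..k}, s (Suc k)) = s"
      using undef by (auto simp: fun_eq_iff restrict_def)
    have e: "entry M (restrict s {1..k}) j = entry M s j" if "j \<le> k" for j using that by (auto simp: entry_def)
    have a: "a \<le> s j \<and> s j \<le> entry M s (j - 1)" if "j \<in> {1..Suc k}" for j
      using s that by (auto simp: chains_def)
    have "restrict s {1..k} \<in> chains a M k"
      unfolding chains_def using a e by (auto simp: PiE_iff)
    moreover have "s (Suc k) \<in> {a..entry M (restrict s {1..k}) k}" using a[of "Suc k"] e[of k] by auto
    ultimately show "(restrict s {1..k}, s (Suc k)) \<in> Sigma (chains a M k) (\<lambda>s. {a..entry M s k})" by simp
  qed
  finally show ?thesis by simp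
qed

text \<open>The composition of the \<open>k\<close> operators taking g to the function n -> sum over
  t of w_j(t) g(t) / (q)_(n-t), evaluated at \<open>M\<close>. The factor at j = 1 is 1/(q)_(M-s_1),
  the one added to the multiple sum.\<close>

definition chain_sum ::
  "complex \<Rightarrow> (nat \<Rightarrow> int \<Rightarrow> complex) \<Rightarrow> int \<Rightarrow> int \<Rightarrow> nat \<Rightarrow> (int \<Rightarrow> complex) \<Rightarrow> complex" where
  "chain_sum q w a M k g = (\<Sum>s\<in>chains a M k.
     (\<Prod>j=1..k. w j (s j) * inv_qfac q (entry M s (j - 1) - s j)) * g (entry M s k))"

lemma chain_sum_0: "chain_sum q w a M 0 g = g M"
  by (simp add: chain_sum_def chains_0 entry_def)

lemma chain_sum_cmult: "chain_sum q w a M k (\<lambda>n. c * g n) = c * chain_sum q w a M k g"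
  by (simp add: chain_sum_def sum_distrib_left mult_ac)

lemma chain_sum_sum: "chain_sum q w a M k (\<lambda>n. \<Sum>j\<in>F. g j n) = (\<Sum>j\<in>F. chain_sum q w a M k (g j))"
  unfolding chain_sum_def sum_distrib_left by (rule sum.swap)

lemma chain_sum_Suc:
  "chain_sum q w a M (Suc k) g
   = chain_sum q w a M k (\<lambda>n. \<Sum>t=a..n. w (Suc k) t * inv_qfac q (n - t) * g t)"
  unfolding chain_sum_def sum_chains_Suc sum_distrib_left
proof (intro sum.cong refl)
  fix s t assume "s \<in> chains a M k"
  let ?s = "s(Suc k := t)"
  have e: "entry M ?s j = entry M s j" if "j \<le> k" for j using that by (auto simp: entry_def)
  have "(\<Prod>j=1..k. w j (?s j) * inv_qfac q (entry M ?s (j - 1) - ?s j)) = (\<Prod>j=1..k. w j (s j) * inv_qfac q (entry M s (j - 1) - s j))"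
    using e by (intro prod.cong refl) (auto simp: entry_def)
  moreover have "entry M ?s (Suc k) = t" by (simp add: entry_def)
  ultimately show "(\<Prod>j=1..Suc k. w j (?s j) * inv_qfac q (entry M ?s (j - 1) - ?s j)) * g (entry M ?s (Suc k))
     = (\<Prod>j=1..k. w j (s j) * inv_qfac q (entry M s (j - 1) - s j)) * (w (Suc k) t * inv_qfac q (entry M s k - t) * g t)"
    using e[of k] by simp
qed

text \<open>The image of the kernel under \<open>l\<close> sums that carry the factor \<open>q\<^bsup>-s\<^esup>\<close>.\<close>

definition lattice_ker :: "complex \<Rightarrow> int \<Rightarrow> int \<Rightarrow> nat \<Rightarrow> int \<Rightarrow> complex" where
  "lattice_ker q m j l n = q powi (int l * (j\<^sup>2 + m * j - j)) *
     ((\<Sum>k<Suc l. q powi ((2 * j + m) * int k)) - q powi (n + j + m) * (\<Sum>k<l. q powi ((2 * j + m) * int k)))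
     * bailey_ker q m j n"

section \<open>Iteration of the Bailey steps\<close>

context half_nome
begin

text \<open>In the correction term q^(t+j+m) cancels the factor q^(-t), so this part sees the plain
  quadratic weight and is diagonal. The leading part uses the step with q^(-t).\<close>

lemma sum_lattice_ker:
  "(\<Sum>t=- (m div 2)..n. q powi (t\<^sup>2 + m * t - t) * inv_qfac q (n - t) * lattice_ker q m j l t)
     = lattice_ker q m j (Suc l) n"
proof -
  let ?S = "\<lambda>l. \<Sum>k<l. q powi ((2 * j + m) * int k)"
  let ?e = "q powi (int l * (j\<^sup>2 + m * j - j))" and ?y = "q powi (2 * j + m)"
  have S: "?S (Suc l) = 1 + ?y * ?S l" for l
    unfolding sum.lessThan_Suc_shift sum_distrib_left
    by (simp add: h_powi algebra_simps)
  have "(\<Sum>t=- (m div 2)..n. q powi (t\<^sup>2 + m * t - t) * inv_qfac q (n - t) * lattice_ker q m j l t)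
    = ?e * ?S (Suc l) * (\<Sum>t=- (m div 2)..n. q powi (t\<^sup>2 + m * t - t) * inv_qfac q (n - t) * bailey_ker q m j t)
      - ?e * q powi (j + m) * ?S l * (\<Sum>t=- (m div 2)..n. q powi (t\<^sup>2 + m * t) * inv_qfac q (n - t) * bailey_ker q m j t)"
    unfolding sum_distrib_left[of "?e * ?S (Suc l)"] sum_distrib_left[of "?e * q powi (j + m) * ?S l"]
      sum_subtractf[symmetric]
  proof (intro sum.cong refl)
    fix t
    have "q powi (t\<^sup>2 + m * t - t) * q powi (t + j + m) = q powi (j + m) * q powi (t\<^sup>2 + m * t)"
      by (simp add: h_powi algebra_simps)
    then have "q powi (t\<^sup>2 + m * t - t) * R * (e * (s - q powi (t + j + m) * s') * k)
       = e * s * (q powi (t\<^sup>2 + m * t - t) * R * k) - e * q powi (j + m) * s' * (q powi (t\<^sup>2 + m * t) * R * k)" for R e s s' k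
      by algebra
    then show "q powi (t\<^sup>2 + m * t - t) * inv_qfac q (n - t) * lattice_ker q m j l t
      = ?e * ?S (Suc l) * (q powi (t\<^sup>2 + m * t - t) * inv_qfac q (n - t) * bailey_ker q m j t)
       - ?e * q powi (j + m) * ?S l * (q powi (t\<^sup>2 + m * t) * inv_qfac q (n - t) * bailey_ker q m j t)"
      unfolding lattice_ker_def by blast
  qed
  also have "\<dots> = ?e * ?S (Suc l) * (q powi (j\<^sup>2 + m * j - j) * (1 + ?y - q powi (n + j + m)) * bailey_ker q m j n)
      - ?e * q powi (j + m) * ?S l * (q powi (j\<^sup>2 + m * j) * bailey_ker q m j n)"
    unfolding sum_ker_square sum_ker_square_minus ..
  also have "\<dots> = lattice_ker q m j (Suc l) n"
  proof -
    have a: "q powi (int (Suc l) * (j\<^sup>2 + m * j - j)) = ?e * q powi (j\<^sup>2 + m * j - j)"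
      by (simp add: h_powi algebra_simps)
    have b: "q powi (j + m) * q powi (j\<^sup>2 + m * j) = q powi (j\<^sup>2 + m * j - j) * ?y"
      by (simp add: h_powi algebra_simps)
    \<comment> \<open>The part free of \<open>w\<close> is s1 + y s1 - y s0 = 1 + y s1 = s2, the
      geometric sum with one more term.\<close>
    have gen: "e * s1 * (f * (1 + y - w) * k) - e * u * s0 * (v * k) = e * f * (s2 - w * s1) * k"
      if "u * v = f * y" "s2 = 1 + y * s1" "s1 = 1 + y * s0" for e f y w k u v s0 s1 s2 :: complex
      using that by algebra
    show ?thesis unfolding lattice_ker_def a by (rule gen[OF b S S])
  qed
  finally show ?thesis .
qed

text \<open>Induction removes the innermost sum, which raises the index of the kernel by one; hence
  \<open>l\<close> is arbitrary.\<close>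

lemma chain_sum_lattice_ker:
  assumes "\<And>j t. 1 \<le> j \<Longrightarrow> j \<le> k \<Longrightarrow> w j t = q powi (t\<^sup>2 + m * t - t)"
  shows "chain_sum q w (- (m div 2)) M k (lattice_ker q m j l) = lattice_ker q m j (k + l) M"
  using assms
proof (induction k arbitrary: l)
  case (Suc k)
  have "chain_sum q w (- (m div 2)) M (Suc k) (lattice_ker q m j l) = chain_sum q w (- (m div 2)) M k (lattice_ker q m j (Suc l))"
    unfolding chain_sum_Suc using Suc.prems[of "Suc k"] sum_lattice_ker[of m _ j l] by simp
  also have "\<dots> = lattice_ker q m j (k + Suc l) M" using Suc.prems by (intro Suc.IH) auto
  finally show ?case by simp
qed (simp add: chain_sum_0)

text \<open>The weights without linear correction sit at the positions beyond \<open>i\<close>, that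
  is innermost, so they act first and each contributes a scalar. The outer \<open>i\<close> sums
  then raise the index of \<open>lattice_ker\<close> from 0 to \<open>i\<close>.\<close>

lemma chain_sum_bailey_ker:
  assumes w: "\<And>j t. w j t = q powi (t\<^sup>2 + m * t - (if j \<le> i then t else 0))"
  shows "chain_sum q w (- (m div 2)) M (i + d) (bailey_ker q m j) = q powi (int d * (j\<^sup>2 + m * j)) * lattice_ker q m j i M"
proof (induction d)
  case 0
  have "bailey_ker q m j = lattice_ker q m j 0" by (simp add: lattice_ker_def fun_eq_iff)
  moreover have "chain_sum q w (- (m div 2)) M i (lattice_ker q m j 0) = lattice_ker q m j (i + 0) M"
    by (rule chain_sum_lattice_ker) (simp add: w)
  ultimately show ?case by simp
next
  case (Suc d)
  have "chain_sum q w (- (m div 2)) M (i + Suc d) (bailey_ker q m j)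
      = chain_sum q w (- (m div 2)) M (i + d) (\<lambda>n. q powi (j\<^sup>2 + m * j) * bailey_ker q m j n)"
    unfolding add_Suc_right chain_sum_Suc w using sum_ker_square[of m _ j] by simp
  then show ?case unfolding chain_sum_cmult Suc by (simp add: h_powi algebra_simps)
qed

end

section \<open>Reduction of the multiple sum\<close>

lemma power_int_sum:
  fixes h :: complex
  assumes "h \<noteq> 0"
  shows "h powi (\<Sum>j\<in>A. f j) = (\<Prod>j\<in>A. h powi f j)"
  by (induction A rule: infinite_finite_induct) (simp_all add: power_int_add assms)

definition lattice_weight :: "complex \<Rightarrow> nat \<Rightarrow> nat \<Rightarrow> nat \<Rightarrow> int \<Rightarrow> complex" where
  "lattice_weight q m i j t = q powi (t\<^sup>2 + int m * t - (if j \<le> i then t else 0))"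

context half_nome
begin

lemma lhs_exponent:
  assumes "i \<le> k"
  shows "h powi (2 * (\<Sum>j=1..Suc k. (s j)\<^sup>2) + int m * (2 * (\<Sum>j=1..k. s j) + s (Suc k)) - 2 * (\<Sum>j=1..i. s j))
     = (\<Prod>j=1..k. lattice_weight q m i j (s j)) * h powi (2 * (s (Suc k))\<^sup>2 + int m * s (Suc k))"
proof -
  have "(\<Sum>j=1..i. s j) = (\<Sum>j=1..k. if j \<le> i then s j else 0)"
    using assms by (intro sum.mono_neutral_cong_left) auto
  then have "2 * (\<Sum>j=1..Suc k. (s j)\<^sup>2) + int m * (2 * (\<Sum>j=1..k. s j) + s (Suc k)) - 2 * (\<Sum>j=1..i. s j)
     = (\<Sum>j=1..k. 2 * ((s j)\<^sup>2 + int m * s j - (if j \<le> i then s j else 0))) + (2 * (s (Suc k))\<^sup>2 + int m * s (Suc k))"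
    by (simp add: sum_distrib_left sum.distrib sum_subtractf algebra_simps)
  then show ?thesis
    unfolding lattice_weight_def h_powi(1) power_int_sum[OF h0, symmetric] by (simp only: h_powi)
qed

lemma qpoch_neg_ratio:
  "qpoch (- (h powi m)) q t / qpoch (- (h powi (2 + m))) q n
   = (1 + h powi m) * (qpoch_inf (- (h powi (m + 2 + 2 * n))) q / qpoch_inf (- (h powi (m + 2 * t))) q)"
proof -
  have "qpoch_inf (- (h powi m)) q = (1 + h powi m) * qpoch_inf (- (h powi (2 + m))) q"
    using neg_qpoch_inf_split[of m 1] by (simp add: add.commute)
  moreover have "- (h powi m) * q powi t = - (h powi (m + 2 * t))"
    "- (h powi (2 + m)) * q powi n = - (h powi (m + 2 + 2 * n))" by (simp_all add: h_powi add_ac)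
  ultimately show ?thesis
    unfolding qpoch_def using neg_qpoch_inf_nonzero by simp
qed

text \<open>Separates what belongs to the operators at positions 1 to \<open>k\<close> from the
  innermost sum over \<open>t\<close>, which carries the q-binomial and the quotient of the two
  shifted factorials.\<close>

lemma lhs_term_factor:
  assumes i: "i \<le> k" and k: "1 \<le> k" and s: "s \<in> chains a M k" and t: "t \<le> s k"
  shows "lhs_term q h m (Suc k) i (s(Suc k := t)) * inv_qfac q (M - s 1)
    = (\<Prod>j=1..k. lattice_weight q m i j (s j) * inv_qfac q (entry M s (j - 1) - s j)) *
      ((1 + h powi int m) * (h powi (2 * t\<^sup>2 + int m * t) * (-1) powi t * qbinom q (int m + t) (int m + 2 * t) *
        (qpoch_inf (- (h powi (int m + 2 + 2 * s k))) q / qpoch_inf (- (h powi (int m + 2 * t))) q) * inv_qfac q (s k - t)))"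
proof -
  let ?s = "s(Suc k := t)" and ?R = "inv_qfac q"
  let ?v = "\<lambda>j. ?R (entry M ?s (j - 1) - ?s j)"
  have dec: "s (Suc j) \<le> s j" if "1 \<le> j" "Suc j \<le> k" for j
  proof -
    have "Suc j \<in> {1..k}" using that by simp
    then have "s (Suc j) \<le> entry M s (Suc j - 1)" using s unfolding chains_def by blast
    then show ?thesis using that by (simp add: entry_def)
  qed
  have ge: "0 \<le> ?s j - ?s (j + 1)" if "j \<in> {1..k}" for j
    using dec[of j] t that by (cases "j = k") auto
  have e: "?s j - ?s (j + 1) = entry M ?s (Suc j - 1) - ?s (Suc j)" if "j \<in> {1..k}" for j
    using that by (simp add: entry_def)
  have "(\<Prod>j=1..k. qpoch q q (?s j - ?s (j + 1))) = 1 / (\<Prod>j=1..k. ?R (?s j - ?s (j + 1)))"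
    unfolding prod_dividef[symmetric, of "\<lambda>_. 1", simplified] using qpoch_self[OF norm_q ge] by (intro prod.cong) auto
  also have "(\<Prod>j=1..k. ?R (?s j - ?s (j + 1))) = (\<Prod>j=1..k. ?v (Suc j))"
    by (intro prod.cong refl arg_cong[where f = ?R] e)
  finally have A: "1 / (\<Prod>j=1..k. qpoch q q (?s j - ?s (j + 1))) = (\<Prod>j=1..k. ?v (Suc j))" by simp
  \<comment> \<open>The k + 1 differences M - s_1, s_1 - s_2, ..., s_k - t are regrouped by
    splitting off the last one instead of the first.\<close>
  have "?v 1 * (\<Prod>j=1..k. ?v (Suc j)) = (\<Prod>j=1..Suc k. ?v j)"
  proof -
    have "(\<Prod>j=1..k. ?v (Suc j)) = (\<Prod>j=Suc 1..Suc k. ?v j)" by (subst prod.shift_bounds_cl_Suc_ivl) simp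
    then show ?thesis using prod.atLeast_Suc_atMost[of 1 "Suc k" ?v] by simp
  qed
  also have "\<dots> = (\<Prod>j=1..k. ?v j) * ?v (Suc k)" by simp
  also have "(\<Prod>j=1..k. ?v j) = (\<Prod>j=1..k. ?R (entry M s (j - 1) - s j))"
    by (intro prod.cong refl) (auto simp: entry_def)
  also have "?v (Suc k) = ?R (s k - t)" using k by (simp add: entry_def)
  also have "?v 1 = ?R (M - s 1)" using k by (simp add: entry_def)
  finally have B: "?R (M - s 1) * (\<Prod>j=1..k. ?v (Suc j)) = (\<Prod>j=1..k. ?R (entry M s (j - 1) - s j)) * ?R (s k - t)" .
  have W: "(\<Prod>j=1..k. lattice_weight q m i j (?s j)) = (\<Prod>j=1..k. lattice_weight q m i j (s j))"
    by (intro prod.cong refl) auto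
  have "lhs_term q h m (Suc k) i ?s = h powi (2 * (\<Sum>j=1..Suc k. (?s j)\<^sup>2) + int m * (2 * (\<Sum>j=1..k. ?s j) + ?s (Suc k)) - 2 * (\<Sum>j=1..i. ?s j))
     * (1 / (\<Prod>j=1..k. qpoch q q (?s j - ?s (j + 1)))) * (qpoch (- (h powi int m)) q t / qpoch (- (h powi (2 + int m))) q (s k))
     * (-1) powi t * qbinom q (int m + t) (int m + 2 * t)"
    unfolding lhs_term_def using k by simp
  also have "\<dots> = (\<Prod>j=1..k. lattice_weight q m i j (s j)) * h powi (2 * t\<^sup>2 + int m * t)
     * (\<Prod>j=1..k. ?v (Suc j)) * ((1 + h powi int m) * (qpoch_inf (- (h powi (int m + 2 + 2 * s k))) q / qpoch_inf (- (h powi (int m + 2 * t))) q))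
     * (-1) powi t * qbinom q (int m + t) (int m + 2 * t)"
    unfolding lhs_exponent[OF i] A W qpoch_neg_ratio by simp
  finally have L: "lhs_term q h m (Suc k) i ?s = \<dots>" .
  have "lhs_term q h m (Suc k) i ?s * ?R (M - s 1) = (\<Prod>j=1..k. lattice_weight q m i j (s j)) * (?R (M - s 1) * (\<Prod>j=1..k. ?v (Suc j)))
     * ((1 + h powi int m) * (h powi (2 * t\<^sup>2 + int m * t) * (-1) powi t * qbinom q (int m + t) (int m + 2 * t) *
        (qpoch_inf (- (h powi (int m + 2 + 2 * s k))) q / qpoch_inf (- (h powi (int m + 2 * t))) q)))"
    unfolding L by (simp only: mult_ac)
  then show ?thesis unfolding B prod.distrib by (simp only: mult_ac)
qed

text \<open>The q-binomial is replaced by the unit Bailey pair and the sums are interchanged. The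
  range of \<open>j\<close> depends only on \<open>M\<close>: as t <= n <= M it contains the support
  of every kernel that occurs.\<close>

lemma sum_inner:
  assumes "n \<le> M"
  shows "(\<Sum>t=- (int m div 2)..n. h powi (2 * t\<^sup>2 + int m * t) * (-1) powi t * qbinom q (int m + t) (int m + 2 * t) *
        (qpoch_inf (- (h powi (int m + 2 + 2 * n))) q / qpoch_inf (- (h powi (int m + 2 * t))) q) * inv_qfac q (n - t))
    = (\<Sum>j=- int m - M..M. (-1) powi j * h powi (2 * j\<^sup>2 + int m * j) / (1 + h powi (int m + 2 * j)) * bailey_ker q (int m) j n)"
proof -
  let ?F = "{- int m - M..M}"
  let ?Q = "\<lambda>t. qpoch_inf (- (h powi (int m + 2 + 2 * n))) q / qpoch_inf (- (h powi (int m + 2 * t))) q"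
  let ?u = "\<lambda>t. h powi (t\<^sup>2 + t + int m * t)"
  have "(\<Sum>t=- (int m div 2)..n. h powi (2 * t\<^sup>2 + int m * t) * (-1) powi t * qbinom q (int m + t) (int m + 2 * t) * ?Q t * inv_qfac q (n - t))
     = (\<Sum>t=- (int m div 2)..n. \<Sum>j\<in>?F. (-1) powi j * h powi (j\<^sup>2 - j) * (?u t * ?Q t * inv_qfac q (n - t) * bailey_ker q (int m) j t))"
  proof (intro sum.cong refl)
    fix t assume t: "t \<in> {- (int m div 2)..n}"
    \<comment> \<open>Part of the exponent is the weight of the Bailey step; the rest, t^2 - t,
      belongs to the unit pair.\<close>
    have p: "h powi (2 * t\<^sup>2 + int m * t) = ?u t * h powi (t\<^sup>2 - t)" by (simp add: h_powi algebra_simps)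
    have "(\<Sum>j\<in>?F. (-1) powi j * h powi (j\<^sup>2 - j) * bailey_ker q (int m) j t)
       = (-1) powi t * h powi (t\<^sup>2 - t) * qbinom q (int m + t) (int m + 2 * t)"
      by (rule unit_bailey_pair) (use t assms in auto)
    then have "h powi (2 * t\<^sup>2 + int m * t) * (-1) powi t * qbinom q (int m + t) (int m + 2 * t) * ?Q t * inv_qfac q (n - t)
       = ?u t * ?Q t * inv_qfac q (n - t) * (\<Sum>j\<in>?F. (-1) powi j * h powi (j\<^sup>2 - j) * bailey_ker q (int m) j t)"
      unfolding p by (simp only: mult_ac)
    also have "\<dots> = (\<Sum>j\<in>?F. (-1) powi j * h powi (j\<^sup>2 - j) * (?u t * ?Q t * inv_qfac q (n - t) * bailey_ker q (int m) j t))"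
      unfolding sum_distrib_left by (simp only: mult_ac)
    finally show "h powi (2 * t\<^sup>2 + int m * t) * (-1) powi t * qbinom q (int m + t) (int m + 2 * t) * ?Q t * inv_qfac q (n - t)
       = (\<Sum>j\<in>?F. (-1) powi j * h powi (j\<^sup>2 - j) * (?u t * ?Q t * inv_qfac q (n - t) * bailey_ker q (int m) j t))" .
  qed
  also have "\<dots> = (\<Sum>j\<in>?F. (-1) powi j * h powi (j\<^sup>2 - j) * (\<Sum>t=- (int m div 2)..n. ?u t * ?Q t * inv_qfac q (n - t) * bailey_ker q (int m) j t))"
    unfolding sum_distrib_left by (rule sum.swap)
  also have "\<dots> = (\<Sum>j\<in>?F. (-1) powi j * h powi (2 * j\<^sup>2 + int m * j) / (1 + h powi (int m + 2 * j)) * bailey_ker q (int m) j n)"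
    unfolding sum_ker_inner
  proof (intro sum.cong refl)
    fix j
    have "h powi (2 * j\<^sup>2 + int m * j) = h powi (j\<^sup>2 - j) * h powi (j\<^sup>2 + j + int m * j)" by (simp add: h_powi algebra_simps)
    then show "(-1) powi j * h powi (j\<^sup>2 - j) * (h powi (j\<^sup>2 + j + int m * j) / (1 + h powi (int m + 2 * j)) * bailey_ker q (int m) j n)
      = (-1) powi j * h powi (2 * j\<^sup>2 + int m * j) / (1 + h powi (int m + 2 * j)) * bailey_ker q (int m) j n" by simp
  qed
  finally show ?thesis .
qed

lemma sum_lhs_chains:
  assumes i: "i \<le> k" and k: "1 \<le> k"
  shows "(\<Sum>s\<in>chains (- (int m div 2)) M (Suc k). lhs_term q h m (Suc k) i s * inv_qfac q (M - s 1))
    = (\<Sum>j=- int m - M..M. (1 + h powi int m) * ((-1) powi j * h powi (2 * j\<^sup>2 + int m * j) / (1 + h powi (int m + 2 * j))) *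
        (q powi (int (k - i) * (j\<^sup>2 + int m * j)) * lattice_ker q (int m) j i M))"
proof -
  let ?a = "- (int m div 2)" and ?w = "lattice_weight q m i"
  let ?c = "\<lambda>j. (1 + h powi int m) * ((-1) powi j * h powi (2 * j\<^sup>2 + int m * j) / (1 + h powi (int m + 2 * j)))"
  let ?W = "\<lambda>s. \<Prod>j=1..k. ?w j (s j) * inv_qfac q (entry M s (j - 1) - s j)"
  have "(\<Sum>s\<in>chains ?a M (Suc k). lhs_term q h m (Suc k) i s * inv_qfac q (M - s 1))
     = (\<Sum>s\<in>chains ?a M k. ?W s * (\<Sum>j=- int m - M..M. ?c j * bailey_ker q (int m) j (entry M s k)))"
    unfolding sum_chains_Suc
  proof (intro sum.cong refl)
    fix s assume s: "s \<in> chains ?a M k"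
    have e: "entry M s k = s k" using k by (simp add: entry_def)
    have sk: "s k \<le> M" using chains_le[OF s, of k] k by simp
    have "(\<Sum>t=?a..s k. lhs_term q h m (Suc k) i (s(Suc k := t)) * inv_qfac q (M - (s(Suc k := t)) 1))
      = (\<Sum>t=?a..s k. ?W s * ((1 + h powi int m) * (h powi (2 * t\<^sup>2 + int m * t) * (-1) powi t * qbinom q (int m + t) (int m + 2 * t) *
        (qpoch_inf (- (h powi (int m + 2 + 2 * s k))) q / qpoch_inf (- (h powi (int m + 2 * t))) q) * inv_qfac q (s k - t))))"
      using lhs_term_factor[OF i k s] k by (intro sum.cong refl) auto
    also have "\<dots> = ?W s * ((1 + h powi int m) * (\<Sum>j=- int m - M..M. (-1) powi j * h powi (2 * j\<^sup>2 + int m * j) / (1 + h powi (int m + 2 * j)) * bailey_ker q (int m) j (s k)))"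
      unfolding sum_distrib_left[symmetric] sum_inner[OF sk] ..
    finally show "(\<Sum>t=?a..entry M s k. lhs_term q h m (Suc k) i (s(Suc k := t)) * inv_qfac q (M - (s(Suc k := t)) 1))
      = ?W s * (\<Sum>j=- int m - M..M. ?c j * bailey_ker q (int m) j (entry M s k))"
      unfolding e sum_distrib_left[of "1 + h powi int m"] by (simp only: mult.assoc)
  qed
  also have "\<dots> = chain_sum q ?w ?a M k (\<lambda>n. \<Sum>j=- int m - M..M. ?c j * bailey_ker q (int m) j n)"
    by (simp only: chain_sum_def)
  also have "\<dots> = (\<Sum>j=- int m - M..M. ?c j * chain_sum q ?w ?a M (i + (k - i)) (bailey_ker q (int m) j))"
    unfolding chain_sum_sum chain_sum_cmult using i by simp
  also have "\<dots> = (\<Sum>j=- int m - M..M. ?c j * (q powi (int (k - i) * (j\<^sup>2 + int m * j)) * lattice_ker q (int m) j i M))"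
    by (subst chain_sum_bailey_ker) (simp_all add: lattice_weight_def)
  finally show ?thesis .
qed

end

section \<open>Summability and the limit\<close>

lemma index_tuples_ge:
  assumes "s \<in> index_tuples m r" "j \<in> {1..r}"
  shows "- (int m div 2) \<le> s j"
proof -
  have f: "\<lfloor>real m / 2\<rfloor> = int m div 2" using floor_divide_of_int_eq[of "int m" 2, where 'a = real] by simp
  have "s r \<le> s j"
  proof -
    have "d < r \<Longrightarrow> s r \<le> s (r - d)" for d
    proof (induction d)
      case (Suc d)
      then have "s (r - Suc d + 1) \<le> s (r - Suc d)"
        using assms(1) unfolding index_tuples_def by auto
      moreover have "r - Suc d + 1 = r - d" using Suc.prems by simp
      ultimately show ?case using Suc by simp
    qed simp
    from this[of "r - j"] show ?thesis using assms(2) by simp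
  qed
  then show ?thesis using assms(1) f unfolding index_tuples_def by simp
qed

lemma index_tuples_chains:
  assumes "1 \<le> r"
  shows "{s \<in> index_tuples m r. s 1 \<le> M} = chains (- (int m div 2)) M r"
proof (intro set_eqI iffI)
  fix s assume s: "s \<in> {s \<in> index_tuples m r. s 1 \<le> M}"
  have "s j \<le> entry M s (j - 1)" if "j \<in> {1..r}" for j
  proof (cases "j = 1")
    case False
    then have "j - 1 \<in> {1..<r}" using that by auto
    then have "s (j - 1 + 1) \<le> s (j - 1)" using s unfolding index_tuples_def by blast
    then show ?thesis using False that by (simp add: entry_def)
  qed (use s in \<open>simp add: entry_def\<close>)
  then show "s \<in> chains (- (int m div 2)) M r"
    using s index_tuples_ge[of s m r] by (auto simp: chains_def index_tuples_def)
next
  fix s assume s: "s \<in> chains (- (int m div 2)) M r"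
  have f: "\<lfloor>real m / 2\<rfloor> = int m div 2" using floor_divide_of_int_eq[of "int m" 2, where 'a = real] by simp
  have a: "- (int m div 2) \<le> s j \<and> s j \<le> entry M s (j - 1)" if "j \<in> {1..r}" for j
    using s that unfolding chains_def by blast
  have "s (j + 1) \<le> s j" if "j \<in> {1..<r}" for j using a[of "j + 1"] that by (simp add: entry_def)
  moreover have "s 1 \<le> M" using a[of 1] assms by (simp add: entry_def)
  moreover have "s r \<ge> - \<lfloor>real m / 2\<rfloor>" using a[of r] assms f by simp
  ultimately show "s \<in> {s \<in> index_tuples m r. s 1 \<le> M}"
    using s unfolding index_tuples_def chains_def by auto
qed

lemma has_sum_finite_sum:
  fixes f :: "'i \<Rightarrow> 'a \<Rightarrow> 'b :: topological_comm_monoid_add"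
  assumes "\<And>i. i \<in> I \<Longrightarrow> (f i has_sum x i) A"
  shows "((\<lambda>a. \<Sum>i\<in>I. f i a) has_sum (\<Sum>i\<in>I. x i)) A"
  using assms by (induction I rule: infinite_finite_induct) (auto intro: has_sum_add)

lemma summable_on_finite_sum:
  fixes f :: "'i \<Rightarrow> 'a \<Rightarrow> 'b :: topological_comm_monoid_add"
  assumes "\<And>i. i \<in> I \<Longrightarrow> f i summable_on A"
  shows "(\<lambda>a. \<Sum>i\<in>I. f i a) summable_on A"
  using assms by (induction I rule: infinite_finite_induct) (auto intro: summable_on_add)

text \<open>What multiplies \<open>1 + h powi m\<close> and the kernel in the j-th term of the
  transformed sum, with \<open>u\<close> indexing the geometric sum.\<close>

definition theta_term ::
  "complex \<Rightarrow> nat \<Rightarrow> nat \<Rightarrow> nat \<Rightarrow> int \<Rightarrow> nat \<Rightarrow> complex" where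
  "theta_term h m k i j u = (-1) powi j *
     h powi (2 * int (Suc k) * j\<^sup>2 + (int m * (2 * int k + 1) - 2 * int i + 4 * int u) * j + 2 * int m * int u)
     / (1 + h powi (int m + 2 * j))"

section \<open>Absolute convergence, and the limit of both sides\<close>

context half_nome
begin

lemma norm_h_powi_le_1: "0 \<le> c \<Longrightarrow> norm (h powi c) \<le> 1"
  using norm_h_powi_lt_1[of c] by (cases "c = 0") auto

text \<open>The q-binomial vanishes for s_r > 0, so together with the lower bound only finitely many
  s_r matter and their contribution is bounded by a maximum. The remaining reciprocal factorials are
  uniformly bounded, which leaves a product of one-variable Gaussians.\<close>

lemma lhs_term_bound:
  assumes i: "i \<le> k" and k: "1 \<le> k"
  obtains C where "\<And>s. s \<in> index_tuples m (Suc k) \<Longrightarrow> norm (lhs_term q h m (Suc k) i s)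
     \<le> C * (\<Prod>j=1..Suc k. norm (if j \<le> k then lattice_weight q m i j (s j) else h powi (2 * (s j)\<^sup>2 + int m * s j)))"
proof -
  let ?D = "\<lambda>t. norm (qpoch (- (h powi int m)) q t * qbinom q (int m + t) (int m + 2 * t))"
  define D where "D = Max (?D ` {- (int m div 2)..0})"
  define C1 where "C1 = exp (1 / (1 - norm q)) / norm (qpoch_inf q q)"
  define C2 where "C2 = exp (1 / (1 - norm q)) / norm (qpoch_inf (- (h powi (2 + int m))) q)"
  have D0: "?D 0 \<le> D" unfolding D_def by (intro Max_ge finite_imageI imageI) auto
  have D: "?D t \<le> D" if "- (int m div 2) \<le> t" for t
  proof (cases "t \<le> 0")
    case True
    then show ?thesis unfolding D_def using that by (intro Max_ge finite_imageI imageI) auto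
  next
    case False
    then have "?D t = 0" by (simp add: qbinom_def)
    also have "\<dots> \<le> D" using order_trans[OF norm_ge_zero D0] .
    finally show ?thesis .
  qed
  have Dnn: "0 \<le> D" using order_trans[OF norm_ge_zero D0] .
  have C1nn: "0 \<le> C1" and C2nn: "0 \<le> C2" by (simp_all add: C1_def C2_def)
  show ?thesis
  proof (rule that[of "C1 ^ k * C2 * D"])
    fix s assume s: "s \<in> index_tuples m (Suc k)"
    have ge: "0 \<le> s j - s (j + 1)" if "j \<in> {1..k}" for j using s that by (auto simp: index_tuples_def)
    have "norm (\<Prod>j=1..k. inv_qfac q (s j - s (j + 1))) \<le> (\<Prod>j=1..k. C1)"
      unfolding prod_norm[symmetric] C1_def by (intro prod_mono conjI norm_ge_zero norm_inv_qfac_le[OF norm_q])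
    also have "(\<Prod>j=1..k. inv_qfac q (s j - s (j + 1))) = 1 / (\<Prod>j=1..k. qpoch q q (s j - s (j + 1)))"
      unfolding prod_dividef[symmetric, of "\<lambda>_. 1", simplified] using qpoch_self[OF norm_q ge] by (intro prod.cong) auto
    finally have A: "norm (1 / (\<Prod>j=1..k. qpoch q q (s j - s (j + 1)))) \<le> C1 ^ k" by simp
    have B: "norm (1 / qpoch (- (h powi (2 + int m))) q (s k)) \<le> C2"
    proof -
      \<comment> \<open>The lower bound on the entries keeps the argument of the infinite product in
        the unit disc.\<close>
      have "0 \<le> 2 + int m + 2 * s k" using index_tuples_ge[OF s, of k] k by simp
      then have n: "norm (h powi (2 + int m + 2 * s k)) \<le> 1" by (rule norm_h_powi_le_1)
      have e: "1 / qpoch (- (h powi (2 + int m))) q (s k) = qpoch_inf (- (h powi (2 + int m + 2 * s k))) q / qpoch_inf (- (h powi (2 + int m))) q"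
        unfolding qpoch_def by (simp add: h_powi)
      show ?thesis unfolding e C2_def norm_divide using n
        by (intro divide_right_mono norm_qpoch_inf_le[OF norm_q]) simp_all
    qed
    have Dt: "?D (s (Suc k)) \<le> D" using D index_tuples_ge[OF s, of "Suc k"] by simp
    let ?G = "(\<Prod>j=1..k. lattice_weight q m i j (s j)) * h powi (2 * (s (Suc k))\<^sup>2 + int m * s (Suc k))"
    have "lhs_term q h m (Suc k) i s = ?G * (1 / (\<Prod>j=1..k. qpoch q q (s j - s (j + 1)))) * (1 / qpoch (- (h powi (2 + int m))) q (s k))
      * (qpoch (- (h powi int m)) q (s (Suc k)) * qbinom q (int m + s (Suc k)) (int m + 2 * s (Suc k))) * (-1) powi s (Suc k)"
      unfolding lhs_exponent[OF i, symmetric] by (simp add: lhs_term_def)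
    then have "norm (lhs_term q h m (Suc k) i s) = norm ?G * norm (1 / (\<Prod>j=1..k. qpoch q q (s j - s (j + 1)))) * norm (1 / qpoch (- (h powi (2 + int m))) q (s k))
      * ?D (s (Suc k))"
      by (simp only: norm_mult norm_power_int norm_minus_cancel norm_one power_int_1_left mult_1_right)
    also have "\<dots> \<le> norm ?G * C1 ^ k * C2 * D"
      by (intro mult_mono A B Dt order_refl mult_nonneg_nonneg norm_ge_zero zero_le_power C1nn C2nn Dnn)
    also have "norm ?G = (\<Prod>j=1..Suc k. norm (if j \<le> k then lattice_weight q m i j (s j) else h powi (2 * (s j)\<^sup>2 + int m * s j)))"
      by (simp add: norm_mult prod_norm[symmetric])
    finally show "norm (lhs_term q h m (Suc k) i s)
     \<le> C1 ^ k * C2 * D * (\<Prod>j=1..Suc k. norm (if j \<le> k then lattice_weight q m i j (s j) else h powi (2 * (s j)\<^sup>2 + int m * s j)))"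
      by (simp only: mult_ac)
  qed
qed

text \<open>The dominating product factorises, hence is summable over all integer tuples, and in
  particular over the decreasing ones.\<close>

lemma lhs_term_abs_summable:
  assumes i: "i \<le> k" and k: "1 \<le> k"
  shows "(\<lambda>s. norm (lhs_term q h m (Suc k) i s)) summable_on index_tuples m (Suc k)"
proof -
  let ?g = "\<lambda>j x. norm (if j \<le> k then lattice_weight q m i j x else h powi (2 * x\<^sup>2 + int m * x))"
  have g: "?g j summable_on UNIV" for j
  proof -
    define b where "b = (if j \<le> k then 2 * int m - (if j \<le> i then 2 else 0) else int m)"
    have "?g j x = norm (h powi (2 * x\<^sup>2 + b * x + 0) * 1 powi x)" for x
      by (simp add: b_def lattice_weight_def h_powi algebra_simps)
    then show ?thesis using summable_on_norm_h_quadratic[of 2 1 b 0] by simp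
  qed
  have "(\<lambda>s. \<Prod>j\<in>{1..Suc k}. ?g j (s j)) summable_on PiE {1..Suc k} (\<lambda>_. UNIV)"
  proof -
    have "Infinite_Set_Sum.abs_summable_on (\<lambda>s. \<Prod>j\<in>{1..Suc k}. ?g j (s j)) (PiE {1..Suc k} (\<lambda>_. UNIV))"
      by (rule abs_summable_on_prod_PiE) (use g in \<open>auto simp: abs_summable_equivalent[symmetric]\<close>)
    then show ?thesis unfolding abs_summable_equivalent[symmetric] by (rule abs_summable_summable)
  qed
  then have S: "(\<lambda>s. \<Prod>j\<in>{1..Suc k}. ?g j (s j)) summable_on index_tuples m (Suc k)"
    by (rule summable_on_subset_banach) (auto simp: index_tuples_def)
  obtain C where C: "\<And>s. s \<in> index_tuples m (Suc k) \<Longrightarrow> norm (lhs_term q h m (Suc k) i s) \<le> C * (\<Prod>j=1..Suc k. ?g j (s j))"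
    using lhs_term_bound[OF i k] by blast
  show ?thesis
    by (rule summable_on_comparison_test[OF summable_on_cmult_right[OF S]]) (use C in auto)
qed

text \<open>The extra factor vanishes for s_1 > M, so the sum over all tuples truncates itself to
  the chains below \<open>M\<close>.\<close>

lemma sum_lhs_LIMSEQ:
  assumes i: "i \<le> k" and k: "1 \<le> k"
  shows "(\<lambda>M. \<Sum>s\<in>chains (- (int m div 2)) (int M) (Suc k). lhs_term q h m (Suc k) i s * inv_qfac q (int M - s 1))
    \<longlonglongrightarrow> infsum (lhs_term q h m (Suc k) i) (index_tuples m (Suc k)) * (1 / qpoch_inf q q)"
proof -
  let ?I = "index_tuples m (Suc k)" and ?f = "lhs_term q h m (Suc k) i"
  define C where "C = exp (1 / (1 - norm q)) / norm (qpoch_inf q q)"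
  have lim: "(\<lambda>M. ?f s * inv_qfac q (int M - s 1)) \<longlonglongrightarrow> ?f s * (1 / qpoch_inf q q)" for s
    using inv_qfac_LIMSEQ_shift[OF norm_q, of "- s 1"] by (intro tendsto_mult_left) simp
  have le: "norm (?f s * inv_qfac q (int M - s 1)) \<le> norm (?f s) * C" for s M
    unfolding norm_mult C_def by (intro mult_left_mono norm_inv_qfac_le[OF norm_q]) auto
  have "(\<lambda>M. infsum (\<lambda>s. ?f s * inv_qfac q (int M - s 1)) ?I) \<longlonglongrightarrow> infsum (\<lambda>s. ?f s * (1 / qpoch_inf q q)) ?I"
    by (rule infsum_dominated_convergence[OF lim le summable_on_cmult_left[OF lhs_term_abs_summable[OF i k]]])
  moreover have "infsum (\<lambda>s. ?f s * inv_qfac q (int M - s 1)) ?I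
     = (\<Sum>s\<in>chains (- (int m div 2)) (int M) (Suc k). ?f s * inv_qfac q (int M - s 1))" for M
  proof -
    have "infsum (\<lambda>s. ?f s * inv_qfac q (int M - s 1)) ?I = infsum (\<lambda>s. ?f s * inv_qfac q (int M - s 1)) {s \<in> ?I. s 1 \<le> int M}"
      by (rule infsum_cong_neutral) auto
    then show ?thesis using index_tuples_chains[of "Suc k" m "int M"] by (simp add: finite_chains)
  qed
  ultimately show ?thesis by (simp only: infsum_cmult_left')
qed

text \<open>For c < 0 write 1 + h^(-c) = h^(-c) (1 + h^c) with |h^(-c)| <= 1. Since the bound is
  uniform in \<open>c\<close>, the denominators do not disturb the Gaussian decay.\<close>

lemma norm_one_plus_h: "1 - norm h \<le> norm (1 + h powi c)"
proof -
  consider "c = 0" | "0 < c" | "c < 0" by linarith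
  then show ?thesis
  proof cases
    case 1
    have "1 - norm h \<le> 2" using norm_ge_zero[of h] by linarith
    then show ?thesis using 1 by simp
  next
    case 2
    have "norm (h powi c) \<le> norm h"
      using 2 norm_h power_int_decreasing[of 1 c "norm h"] h0 by (simp add: norm_power_int)
    then show ?thesis using norm_triangle_ineq2[of 1 "- (h powi c)"] by simp
  next
    case 3
    have "norm (h powi (- c)) \<le> norm h"
      using 3 norm_h power_int_decreasing[of 1 "- c" "norm h"] h0 by (simp add: norm_power_int)
    then have "1 - norm h \<le> norm (1 + h powi (- c))" using norm_triangle_ineq2[of 1 "- (h powi (- c))"] by simp
    also have "1 + h powi (- c) = h powi (- c) * (1 + h powi c)" by (simp add: distrib_left h_powi)
    also have "norm \<dots> \<le> 1 * norm (1 + h powi c)" unfolding norm_mult using 3 by (intro mult_right_mono norm_h_powi_le_1) auto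
    finally show ?thesis by simp
  qed
qed

lemma theta_term_abs_summable: "(\<lambda>j. norm (theta_term h m k i j u)) summable_on UNIV"
proof -
  let ?e = "\<lambda>j. 2 * int (Suc k) * j\<^sup>2 + (int m * (2 * int k + 1) - 2 * int i + 4 * int u) * j + 2 * int m * int u"
  have "(\<lambda>j. norm (h powi ?e j * 1 powi j) * (1 / (1 - norm h))) summable_on UNIV"
    by (intro summable_on_cmult_left summable_on_norm_h_quadratic) auto
  then show ?thesis
  proof (rule summable_on_comparison_test)
    fix j
    have "norm (theta_term h m k i j u) = norm (h powi ?e j) * (1 / norm (1 + h powi (int m + 2 * j)))"
      by (simp add: theta_term_def norm_mult norm_divide norm_power_int)
    also have "\<dots> \<le> norm (h powi ?e j) * (1 / (1 - norm h))"
      using norm_one_plus_h norm_h one_plus_h_nonzero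
      by (intro mult_left_mono divide_left_mono mult_pos_pos) auto
    finally show "norm (theta_term h m k i j u) \<le> norm (h powi ?e j * 1 powi j) * (1 / (1 - norm h))" by simp
  qed simp
qed

lemma lattice_term_eq:
  assumes "i \<le> k"
  shows "(1 + h powi int m) * ((-1) powi j * h powi (2 * j\<^sup>2 + int m * j) / (1 + h powi (int m + 2 * j))) *
        (q powi (int (k - i) * (j\<^sup>2 + int m * j)) * lattice_ker q (int m) j i M)
   = (1 + h powi int m) * ((\<Sum>u<Suc i. theta_term h m k i j u) - q powi (M + j + int m) * (\<Sum>u<i. theta_term h m k i j u)) * bailey_ker q (int m) j M"
proof -
  let ?c = "(-1) powi j * h powi (2 * j\<^sup>2 + int m * j) / (1 + h powi (int m + 2 * j)) * q powi (int (k - i) * (j\<^sup>2 + int m * j)) * q powi (int i * (j\<^sup>2 + int m * j - j))"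
  have t: "theta_term h m k i j u = ?c * q powi ((2 * j + int m) * int u)" for u
  proof -
    have "2 * int (Suc k) * j\<^sup>2 + (int m * (2 * int k + 1) - 2 * int i + 4 * int u) * j + 2 * int m * int u
      = (2 * j\<^sup>2 + int m * j) + 2 * (int (k - i) * (j\<^sup>2 + int m * j)) + 2 * (int i * (j\<^sup>2 + int m * j - j)) + 2 * ((2 * j + int m) * int u)"
      using assms by (simp add: of_nat_diff algebra_simps)
    then have "h powi (2 * int (Suc k) * j\<^sup>2 + (int m * (2 * int k + 1) - 2 * int i + 4 * int u) * j + 2 * int m * int u)
      = h powi (2 * j\<^sup>2 + int m * j) * q powi (int (k - i) * (j\<^sup>2 + int m * j)) * q powi (int i * (j\<^sup>2 + int m * j - j)) * q powi ((2 * j + int m) * int u)"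
      by (simp only: h_powi)
    then show ?thesis unfolding theta_term_def by simp
  qed
  show ?thesis unfolding t sum_distrib_left[symmetric] lattice_ker_def
    by (simp only: right_diff_distrib left_diff_distrib times_divide_eq_left times_divide_eq_right mult_ac)
qed

lemma lattice_LIMSEQ:
  assumes i: "i \<le> k"
  shows "(\<lambda>M. \<Sum>j=- int m - int M..int M. (1 + h powi int m) * ((-1) powi j * h powi (2 * j\<^sup>2 + int m * j) / (1 + h powi (int m + 2 * j))) *
        (q powi (int (k - i) * (j\<^sup>2 + int m * j)) * lattice_ker q (int m) j i (int M)))
    \<longlonglongrightarrow> (1 + h powi int m) * infsum (\<lambda>j. \<Sum>u<Suc i. theta_term h m k i j u) UNIV * (1 / qpoch_inf q q * (1 / qpoch_inf q q))"
proof -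
  let ?P = "1 / qpoch_inf q q" and ?K = "bailey_ker q (int m)"
  let ?T = "\<lambda>l j. \<Sum>u<l. theta_term h m k i j u"
  let ?N = "\<lambda>j. \<Sum>u<Suc i. norm (theta_term h m k i j u)"
  define C where "C = exp (1 / (1 - norm q)) / norm (qpoch_inf q q)"
  let ?f = "\<lambda>M j. (1 + h powi int m) * (?T (Suc i) j - q powi (int M + j + int m) * ?T i j) * ?K j (int M)"
  have C0: "0 \<le> C" by (simp add: C_def)
  have K: "norm (?K j (int M)) \<le> C * C" for j M
    unfolding bailey_ker_def norm_mult C_def by (intro mult_mono norm_inv_qfac_le[OF norm_q]) auto
  have g: "(\<lambda>j. norm (1 + h powi int m) * (2 * ?N j) * (C * C)) summable_on UNIV"
    by (intro summable_on_cmult_left summable_on_cmult_right summable_on_finite_sum theta_term_abs_summable)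
  have le: "norm (?f M j) \<le> norm (1 + h powi int m) * (2 * ?N j) * (C * C)" for M j
  proof (cases "?K j (int M) = 0")
    case True
    then show ?thesis using C0 by (simp add: sum_nonneg)
  next
    case False
    \<comment> \<open>Only on the support of the kernel is the power of q in the correction bounded
      by 1.\<close>
    then have "0 \<le> int M + j + int m" using bailey_ker_eq_0[of j "int m" "int M" q] by fastforce
    then have 1: "norm (q powi (int M + j + int m)) \<le> 1" unfolding h_powi(1) by (intro norm_h_powi_le_1) simp
    have 2: "norm (?T i j) \<le> ?N j"
      by (rule order_trans[OF norm_sum]) (simp add: sum_nonneg)
    have 3: "norm (?T (Suc i) j) \<le> ?N j" by (rule norm_sum)
    have "norm (?T (Suc i) j - q powi (int M + j + int m) * ?T i j) \<le> norm (?T (Suc i) j) + norm (q powi (int M + j + int m)) * norm (?T i j)"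
      using norm_triangle_ineq4 by (metis norm_mult)
    also have "\<dots> \<le> ?N j + 1 * ?N j" by (intro add_mono mult_mono 1 2 3) auto
    finally have "norm (?T (Suc i) j - q powi (int M + j + int m) * ?T i j) \<le> 2 * ?N j" by simp
    then show ?thesis unfolding norm_mult[of "_ * _"] norm_mult[of "1 + h powi int m"]
      using K[of j M] by (intro mult_mono order_refl mult_nonneg_nonneg) (auto intro!: sum_nonneg add_nonneg_nonneg)
  qed
  have lim: "(\<lambda>M. ?f M j) \<longlonglongrightarrow> (1 + h powi int m) * (?T (Suc i) j - 0 * ?T i j) * (?P * ?P)" for j
  proof (intro tendsto_intros)
    have "(\<lambda>M. q ^ M * q powi (j + int m)) \<longlonglongrightarrow> 0 * q powi (j + int m)"
      by (intro tendsto_mult_right LIMSEQ_power_zero norm_q)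
    then show "(\<lambda>M. q powi (int M + j + int m)) \<longlonglongrightarrow> 0" by (simp add: h_powi algebra_simps)
    show "(\<lambda>M. ?K j (int M)) \<longlonglongrightarrow> ?P * ?P"
      unfolding bailey_ker_def using inv_qfac_LIMSEQ_shift[OF norm_q, of "- j"] inv_qfac_LIMSEQ_shift[OF norm_q, of "j + int m"]
      by (intro tendsto_mult) (simp_all add: add_ac)
  qed
  have "(\<lambda>M. infsum (?f M) UNIV) \<longlonglongrightarrow> infsum (\<lambda>j. (1 + h powi int m) * (?T (Suc i) j - 0 * ?T i j) * (?P * ?P)) UNIV"
    by (rule infsum_dominated_convergence[OF lim le g])
  moreover have "infsum (\<lambda>j. (1 + h powi int m) * (?T (Suc i) j - 0 * ?T i j) * (?P * ?P)) UNIV = (1 + h powi int m) * infsum (?T (Suc i)) UNIV * (?P * ?P)"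
    unfolding infsum_cmult_left' mult_zero_left diff_zero infsum_cmult_right' ..
  moreover have "infsum (?f M) UNIV = (\<Sum>j=- int m - int M..int M. ?f M j)" for M
  proof -
    have "infsum (?f M) UNIV = infsum (?f M) {- int m - int M..int M}"
      using bailey_ker_eq_0[of _ "int m" "int M" q] by (intro infsum_cong_neutral) auto
    then show ?thesis by simp
  qed
  ultimately show ?thesis unfolding lattice_term_eq[OF i] by (simp only:)
qed

text \<open>Two evaluations of one limit. The multiple sum carries one factor 1/(q)_infinity and the
  kernel two, which leaves one.\<close>

lemma infsum_lhs_term:
  assumes i: "i \<le> k" and k: "1 \<le> k"
  shows "infsum (lhs_term q h m (Suc k) i) (index_tuples m (Suc k))
    = (1 + h powi int m) / qpoch_inf q q * infsum (\<lambda>j. \<Sum>u<Suc i. theta_term h m k i j u) UNIV"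
proof -
  have "infsum (lhs_term q h m (Suc k) i) (index_tuples m (Suc k)) * (1 / qpoch_inf q q)
    = (1 + h powi int m) * infsum (\<lambda>j. \<Sum>u<Suc i. theta_term h m k i j u) UNIV * (1 / qpoch_inf q q * (1 / qpoch_inf q q))"
    using sum_lhs_LIMSEQ[OF i k, of m] lattice_LIMSEQ[OF i, of m]
    unfolding sum_lhs_chains[OF i k] by (rule LIMSEQ_unique)
  then show ?thesis using qpoch_inf_self_nonzero[OF norm_q] by (simp add: field_simps)
qed

end

section \<open>Theta series\<close>

lemma sum_lessThan_double: "(\<Sum>l<2 * n. f l) = (\<Sum>l<n. f (2 * l) + f (2 * l + 1) :: complex)" for n :: nat
  by (induction n) (simp_all add: add_ac)

lemma sum_int_nat: "(\<Sum>k=0..int i. f k) = (\<Sum>k<Suc i. f (int k))"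
  by (rule sum.reindex_bij_witness[where i = int and j = nat]) auto

context half_nome
begin

text \<open>Read off the series: replacing j by j + p permutes the integers and pulls out a
  monomial.\<close>

lemma triple_product_quasi_period:
  assumes "z \<noteq> 0"
  shows "qpoch_inf3 q z (q / z) q = (-1) powi p * z powi p * h powi (p\<^sup>2 - p) *
     qpoch_inf3 q (q powi p * z) (q / (q powi p * z)) q"
proof -
  let ?t = "\<lambda>z j. (-1) powi j * h powi (j\<^sup>2 - j) * z powi j"
  have q0: "q powi p * z \<noteq> 0" using assms h0 by (simp add: q_def)
  have "((\<lambda>j. ?t z (j + p)) has_sum qpoch_inf3 q z (q / z) q) UNIV"
  proof (subst has_sum_reindex_bij_betw[where g = "\<lambda>j. j + p" and f = "?t z"])
    show "bij_betw (\<lambda>j. j + p) UNIV UNIV" by (rule bij_betwI[where g = "\<lambda>j. j - p"]) auto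
  qed (rule jacobi_triple_product[OF assms])
  moreover have "?t z (j + p) = ((-1) powi p * z powi p * h powi (p\<^sup>2 - p)) * ?t (q powi p * z) j" for j
  proof -
    have "(-1) powi (j + p) = (-1) powi p * ((-1) powi j :: complex)" by (simp add: neg_one_powi)
    moreover have "z powi (j + p) = z powi p * z powi j" using assms by (simp add: power_int_add mult_ac)
    moreover have "h powi ((j + p)\<^sup>2 - (j + p)) = h powi (p\<^sup>2 - p) * (h powi (j\<^sup>2 - j) * (q powi p) powi j)"
      by (simp add: h_powi power_int_mult[symmetric] algebra_simps power2_eq_square)
    ultimately show ?thesis by (simp add: power_int_mult_distrib)
  qed
  ultimately have "((\<lambda>j. ((-1) powi p * z powi p * h powi (p\<^sup>2 - p)) * ?t (q powi p * z) j) has_sum qpoch_inf3 q z (q / z) q) UNIV"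
    by simp
  moreover have "((\<lambda>j. ((-1) powi p * z powi p * h powi (p\<^sup>2 - p)) * ?t (q powi p * z) j) has_sum
     ((-1) powi p * z powi p * h powi (p\<^sup>2 - p)) * qpoch_inf3 q (q powi p * z) (q / (q powi p * z)) q) UNIV"
    by (intro has_sum_cmult_right jacobi_triple_product[OF q0])
  ultimately show ?thesis by (rule has_sum_unique)
qed

text \<open>Put y = q^(j+m/2). The partner (-m-j, i-u) has the same numerator times (-1)^m y^m, and
  its denominator contributes another y. The pair thus has the factor (1 + (-1)^m y^(m+1)) / (1 +
  y), the sum of (-y)^l for l = 0, ..., m.\<close>

lemma theta_term_sym:
  assumes "u \<le> i"
  shows "theta_term h m k i j u + theta_term h m k i (- int m - j) (i - u)
    = (\<Sum>l<Suc m. (-1) ^ l * h powi (2 * int m * int u + int m * int l) *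
        ((-1) powi j * (h ^ (2 * Suc k)) powi (j\<^sup>2 - j) *
          (h powi (2 * int (Suc k) + int m * (2 * int k + 1) - 2 * int i + 4 * int u + 2 * int l)) powi j))"
proof -
  let ?e = "2 * int (Suc k) * j\<^sup>2 + (int m * (2 * int k + 1) - 2 * int i + 4 * int u) * j + 2 * int m * int u"
  let ?y = "h powi (int m + 2 * j)"
  have nz: "1 + ?y \<noteq> 0" by (rule one_plus_h_nonzero)
  have nz': "1 + h powi (- (int m + 2 * j)) \<noteq> 0" by (rule one_plus_h_nonzero)
  have a: "theta_term h m k i j u = (-1) powi j * h powi ?e / (1 + ?y)" by (simp add: theta_term_def)
  have b: "theta_term h m k i (- int m - j) (i - u) = (-1) powi j * h powi ?e * ((-1) ^ m * ?y ^ Suc m) / (1 + ?y)"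
  proof -
    have e: "2 * int (Suc k) * (- int m - j)\<^sup>2 + (int m * (2 * int k + 1) - 2 * int i + 4 * int (i - u)) * (- int m - j) + 2 * int m * int (i - u)
       = ?e + (int m + 2 * j) * int m"
      using assms by (simp add: of_nat_diff algebra_simps power2_eq_square)
    have "(-1) powi (- int m - j) = (-1) powi j * ((-1) ^ m :: complex)"
      by (auto simp: neg_one_powi minus_one_power_iff)
    moreover have "1 / (1 + h powi (int m + 2 * (- int m - j))) = ?y / (1 + ?y)"
    proof -
      have "?y * (1 + h powi (- (int m + 2 * j))) = 1 + ?y" by (simp add: distrib_left h_powi)
      moreover have "int m + 2 * (- int m - j) = - (int m + 2 * j)" by simp
      ultimately show ?thesis using nz nz' by (simp add: divide_simps)
    qed
    moreover have "h powi (?e + (int m + 2 * j) * int m) = h powi ?e * ?y ^ m" by (simp add: h_powi)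
    moreover have "theta_term h m k i (- int m - j) (i - u)
       = (-1) powi (- int m - j) * h powi (?e + (int m + 2 * j) * int m) * (1 / (1 + h powi (int m + 2 * (- int m - j))))"
      unfolding theta_term_def e by simp
    ultimately have "theta_term h m k i (- int m - j) (i - u) = (-1) powi j * (-1) ^ m * (h powi ?e * ?y ^ m) * (?y / (1 + ?y))"
      by (simp only:)
    then show ?thesis unfolding times_divide_eq_right power_Suc by (simp only: mult_ac)
  qed
  have "1 - (- ?y) ^ Suc m = (1 + ?y) * (\<Sum>l<Suc m. (- ?y) ^ l)" using one_diff_power_eq[of "- ?y" "Suc m"] by simp
  moreover have "(- ?y) ^ Suc m = - ((-1) ^ m * ?y ^ Suc m)" by (subst power_minus) simp
  ultimately have g: "1 + (-1) ^ m * ?y ^ Suc m = (1 + ?y) * (\<Sum>l<Suc m. (- ?y) ^ l)"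
    by (simp only: diff_minus_eq_add)
  have "theta_term h m k i j u + theta_term h m k i (- int m - j) (i - u) = (-1) powi j * h powi ?e * (1 + (-1) ^ m * ?y ^ Suc m) / (1 + ?y)"
    unfolding a b by (simp only: add_divide_distrib distrib_left mult_1_right)
  also have "\<dots> = (\<Sum>l<Suc m. (-1) powi j * h powi ?e * (- ?y) ^ l)"
    unfolding g sum_distrib_left[symmetric] using nz by (simp del: sum.lessThan_Suc)
  also have "\<dots> = (\<Sum>l<Suc m. (-1) ^ l * h powi (2 * int m * int u + int m * int l) *
        ((-1) powi j * (h ^ (2 * Suc k)) powi (j\<^sup>2 - j) *
          (h powi (2 * int (Suc k) + int m * (2 * int k + 1) - 2 * int i + 4 * int u + 2 * int l)) powi j))"
  proof (intro sum.cong refl)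
    fix l
    have "(- ?y) ^ l = (-1) ^ l * h powi ((int m + 2 * j) * int l)" by (subst power_minus) (simp add: power_int_power')
    moreover have "h powi ?e * h powi ((int m + 2 * j) * int l) = h powi (2 * int m * int u + int m * int l) * ((h ^ (2 * Suc k)) powi (j\<^sup>2 - j) *
          (h powi (2 * int (Suc k) + int m * (2 * int k + 1) - 2 * int i + 4 * int u + 2 * int l)) powi j)"
      unfolding power_int_power power_int_mult[symmetric] h_powi(3) h_powi(4) by (rule arg_cong[where f = "power_int h"]) (simp add: algebra_simps power2_eq_square)
    ultimately show "(-1) powi j * h powi ?e * (- ?y) ^ l = (-1) ^ l * h powi (2 * int m * int u + int m * int l) *
        ((-1) powi j * (h ^ (2 * Suc k)) powi (j\<^sup>2 - j) *
          (h powi (2 * int (Suc k) + int m * (2 * int k + 1) - 2 * int i + 4 * int u + 2 * int l)) powi j)"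
      by (simp only: mult_ac)
  qed
  finally show ?thesis .
qed

text \<open>Adding the series to its reflection doubles it, whence the factor 1/2 in
  \<open>b_even\<close> and \<open>b_odd\<close>. Jacobi's identity is used at base q^(2r) with r =
  k + 1.\<close>

lemma infsum_theta_term:
  "2 * infsum (\<lambda>j. \<Sum>u<Suc i. theta_term h m k i j u) UNIV
   = (\<Sum>u<Suc i. \<Sum>l<Suc m. (-1) ^ l * h powi (2 * int m * int u + int m * int l) *
       qpoch_inf3 (q ^ (2 * Suc k))
         (h powi (2 * int (Suc k) + int m * (2 * int k + 1) - 2 * int i + 4 * int u + 2 * int l))
         (q ^ (2 * Suc k) / h powi (2 * int (Suc k) + int m * (2 * int k + 1) - 2 * int i + 4 * int u + 2 * int l))
         (q ^ (2 * Suc k)))" (is "_ = ?V")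
proof -
  let ?X = "\<lambda>j. \<Sum>u<Suc i. theta_term h m k i j u"
  have "?X summable_on UNIV"
    by (intro summable_on_finite_sum abs_summable_summable[OF theta_term_abs_summable])
  then have X: "(?X has_sum infsum ?X UNIV) UNIV" by (rule has_sum_infsum)
  have X': "((\<lambda>j. ?X (- int m - j)) has_sum infsum ?X UNIV) UNIV"
    using has_sum_reindex_bij_witness[of UNIV "\<lambda>j. - int m - j" "\<lambda>j. - int m - j" UNIV "\<lambda>j. ?X (- int m - j)" ?X
       "infsum ?X UNIV" "infsum ?X UNIV"] X by simp
  let ?h = "h ^ (2 * Suc k)"
  have hh: "half_nome ?h (q ^ (2 * Suc k))"
    by (rule half_nome_power) simp
  have eq: "?X j + ?X (- int m - j) = (\<Sum>u<Suc i. \<Sum>l<Suc m. (-1) ^ l * h powi (2 * int m * int u + int m * int l) *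
        ((-1) powi j * ?h powi (j\<^sup>2 - j) *
          (h powi (2 * int (Suc k) + int m * (2 * int k + 1) - 2 * int i + 4 * int u + 2 * int l)) powi j))" for j
  proof -
    \<comment> \<open>The reflection pairs \<open>u\<close> with \<open>i - u\<close>, so the
      geometric sum is read backwards.\<close>
    have "?X (- int m - j) = (\<Sum>u<Suc i. theta_term h m k i (- int m - j) (i - u))"
      by (subst sum.nat_diff_reindex[symmetric]) simp
    then have "?X j + ?X (- int m - j) = (\<Sum>u<Suc i. theta_term h m k i j u + theta_term h m k i (- int m - j) (i - u))"
      by (simp only: sum.distrib)
    also have "\<dots> = (\<Sum>u<Suc i. \<Sum>l<Suc m. (-1) ^ l * h powi (2 * int m * int u + int m * int l) *
        ((-1) powi j * ?h powi (j\<^sup>2 - j) *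
          (h powi (2 * int (Suc k) + int m * (2 * int k + 1) - 2 * int i + 4 * int u + 2 * int l)) powi j))"
      by (intro sum.cong refl theta_term_sym) simp
    finally show ?thesis .
  qed
  have "((\<lambda>j. ?X j + ?X (- int m - j)) has_sum ?V) UNIV"
    unfolding eq using h0 by (intro has_sum_finite_sum has_sum_cmult_right half_nome.jacobi_triple_product[OF hh]) simp
  moreover have "((\<lambda>j. ?X j + ?X (- int m - j)) has_sum (infsum ?X UNIV + infsum ?X UNIV)) UNIV"
    by (rule has_sum_add[OF X X'])
  ultimately have "?V = infsum ?X UNIV + infsum ?X UNIV" by (rule has_sum_unique)
  then show ?thesis by simp
qed

section \<open>Comparison with the two closed forms\<close>

lemma b_even_eq:
  "b_even q (int r) (int i) (int p) = (1 + h powi int (2 * p)) / (2 * qpoch_inf q q) *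
     (\<Sum>u<Suc i. \<Sum>l<Suc (2 * p). (-1) ^ l * h powi (2 * int (2 * p) * int u + int (2 * p) * int l) *
       qpoch_inf3 (q ^ (2 * r))
         (h powi (2 * int r + int (2 * p) * (2 * int r - 1) - 2 * int i + 4 * int u + 2 * int l))
         (q ^ (2 * r) / h powi (2 * int r + int (2 * p) * (2 * int r - 1) - 2 * int i + 4 * int u + 2 * int l))
         (q ^ (2 * r)))"
proof -
  have two: "2 * int p = int (2 * p)" by simp
  have base: "q powi (2 * int r) = q ^ (2 * r)" using power_int_of_nat[of q "2 * r"] by simp
  show ?thesis unfolding b_even_def two sum_int_nat base
  proof (intro arg_cong2[where f = "(*)"] arg_cong2[where f = "(/)"] arg_cong2[where f = "(+)"] sum.cong refl)
    show "q powi int p = h powi int (2 * p)" by (simp add: h_powi)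
    fix u l
    have a: "q powi (int (2 * p) * int r + int r - int i - int p + 2 * int u + int l)
       = h powi (2 * int r + int (2 * p) * (2 * int r - 1) - 2 * int i + 4 * int u + 2 * int l)"
      unfolding h_powi(1) by (rule arg_cong[where f = "power_int h"]) (simp add: algebra_simps)
    have b: "q powi (int r + int i - int (2 * p) * int r + int p - 2 * int u - int l)
       = q ^ (2 * r) / h powi (2 * int r + int (2 * p) * (2 * int r - 1) - 2 * int i + 4 * int u + 2 * int l)"
      unfolding h_powi(1,2) power_int_diff[OF disjI1[OF h0], symmetric] by (rule arg_cong[where f = "power_int h"]) (simp add: algebra_simps)
    show "qpoch_inf3 (q ^ (2 * r)) (q powi (int (2 * p) * int r + int r - int i - int p + 2 * int u + int l))
       (q powi (int r + int i - int (2 * p) * int r + int p - 2 * int u - int l)) (q ^ (2 * r))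
     = qpoch_inf3 (q ^ (2 * r))
         (h powi (2 * int r + int (2 * p) * (2 * int r - 1) - 2 * int i + 4 * int u + 2 * int l))
         (q ^ (2 * r) / h powi (2 * int r + int (2 * p) * (2 * int r - 1) - 2 * int i + 4 * int u + 2 * int l))
         (q ^ (2 * r))" unfolding a b ..
    show "(-1) powi int l = ((-1) ^ l :: complex)" by simp
    show "q powi (int (2 * p) * int u + int p * int l) = h powi (2 * int (2 * p) * int u + int (2 * p) * int l)"
      by (simp add: h_powi algebra_simps)
  qed
qed

text \<open>The series produces arguments that exceed the stated ones by \<open>p\<close> periods
  q^(2r). Undoing this by quasi-periodicity creates the monomial and the sign in front; grouping the
  2p + 2 values of \<open>l\<close> in pairs gives the differences with the factor q^(1/2).\<close>

lemma b_odd_eq: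
  assumes "1 \<le> r"
  shows "b_odd q h (int r) (int i) (int p) = (1 + h powi int (2 * p + 1)) / (2 * qpoch_inf q q) *
     (\<Sum>u<Suc i. \<Sum>l<2 * Suc p. (-1) ^ l * h powi (2 * int (2 * p + 1) * int u + int (2 * p + 1) * int l) *
       qpoch_inf3 (q ^ (2 * r))
         (h powi (2 * int r + int (2 * p + 1) * (2 * int r - 1) - 2 * int i + 4 * int u + 2 * int l))
         (q ^ (2 * r) / h powi (2 * int r + int (2 * p + 1) * (2 * int r - 1) - 2 * int i + 4 * int u + 2 * int l))
         (q ^ (2 * r)))"
proof -
  let ?h = "h ^ (2 * r)" and ?b = "q ^ (2 * r)"
  have hh: "half_nome ?h ?b"
    by (rule half_nome_power) (use assms in simp)
  have base: "q powi (2 * int r) = ?b" using power_int_of_nat[of q "2 * r"] by simp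
  let ?pre = "(-1) powi int p * h powi (2 * (1 - int r) * (int p)\<^sup>2 + (1 + 2 * int i - 2 * int r) * int p)"
  \<comment> \<open>The exponent of \<open>h\<close> after removing \<open>p\<close> periods. Even
    \<open>l\<close> gives the argument with -1/2 and odd \<open>l\<close> the one with
    +1/2.\<close>
  define Z where "Z u l = 2 * (2 * int r - int i - int p + 2 * int u) + int l * 2 - 1" for u l
  define T where "T u l = qpoch_inf3 ?b (h powi Z u l) (?b / h powi Z u l) ?b" for u l
  have shift: "(-1) ^ l * h powi (2 * int (2 * p + 1) * int u + int (2 * p + 1) * int l) *
       qpoch_inf3 ?b
         (h powi (2 * int r + int (2 * p + 1) * (2 * int r - 1) - 2 * int i + 4 * int u + 2 * int l))
         (?b / h powi (2 * int r + int (2 * p + 1) * (2 * int r - 1) - 2 * int i + 4 * int u + 2 * int l))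
         ?b = ?pre * ((-1) ^ l * h powi (2 * int u + int l) * T u l)" for u l
  proof -
    let ?z = "h powi Z u l" and ?P = "int p"
    have e: "h powi (2 * int r + int (2 * p + 1) * (2 * int r - 1) - 2 * int i + 4 * int u + 2 * int l) = ?b powi ?P * ?z"
      unfolding h_powi(2) power_int_mult[symmetric] h_powi(3) Z_def by (rule arg_cong[where f = "power_int h"]) (simp add: algebra_simps)
    have z: "?z \<noteq> 0" using h0 by simp
    have q': "T u l = (-1) powi ?P * ?z powi ?P * ?h powi (?P\<^sup>2 - ?P) * qpoch_inf3 ?b (?b powi ?P * ?z) (?b / (?b powi ?P * ?z)) ?b"
      unfolding T_def by (rule half_nome.triple_product_quasi_period[OF hh z])
    have c: "h powi (2 * (1 - int r) * ?P\<^sup>2 + (1 + 2 * int i - 2 * int r) * ?P) * h powi (2 * int u + int l) * (?z powi ?P * ?h powi (?P\<^sup>2 - ?P))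
       = h powi (2 * int (2 * p + 1) * int u + int (2 * p + 1) * int l)"
      unfolding power_int_power power_int_mult[symmetric] h_powi(3) Z_def
      by (rule arg_cong[where f = "power_int h"]) (simp add: algebra_simps power2_eq_square)
    have s: "(-1) powi ?P * (-1) powi ?P = (1 :: complex)" by (simp add: neg_one_powi)
    have "?pre * ((-1) ^ l * h powi (2 * int u + int l) * T u l)
      = ((-1) powi ?P * (-1) powi ?P) * (-1) ^ l * (h powi (2 * (1 - int r) * ?P\<^sup>2 + (1 + 2 * int i - 2 * int r) * ?P) * h powi (2 * int u + int l) * (?z powi ?P * ?h powi (?P\<^sup>2 - ?P)))
         * qpoch_inf3 ?b (?b powi ?P * ?z) (?b / (?b powi ?P * ?z)) ?b"
      unfolding q' by (simp only: mult_ac)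
    then show ?thesis unfolding c s e by simp
  qed
  have "b_odd q h (int r) (int i) (int p) = ?pre * ((1 + h powi int (2 * p + 1)) / (2 * qpoch_inf q q)) *
     (\<Sum>u<Suc i. \<Sum>l<Suc p. q powi (int u + int l) * (T u (2 * l) - h * T u (2 * l + 1)))"
    unfolding b_odd_def sum_int_nat base
  proof (intro arg_cong2[where f = "(*)"] arg_cong2[where f = "(/)"] arg_cong2[where f = "(+)"] arg_cong2[where f = "(-)"] sum.cong refl)
    show "h powi (2 * int p + 1) = h powi int (2 * p + 1)" by (simp add: add.commute)
    fix u l
    have a: "h powi (2 * (2 * int r - int i - int p + 2 * int u + 2 * int l) - 1) = h powi Z u (2 * l)"
      "h powi (2 * (2 * int r - int i - int p + 2 * int u + 2 * int l) + 1) = h powi Z u (2 * l + 1)"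
      by (rule arg_cong[where f = "power_int h"], simp add: Z_def algebra_simps)+
    have b: "h powi (2 * (int i + int p - 2 * int u - 2 * int l) + 1) = ?b / h powi Z u (2 * l)"
      "h powi (2 * (int i + int p - 2 * int u - 2 * int l) - 1) = ?b / h powi Z u (2 * l + 1)"
      unfolding h_powi(2) power_int_diff[OF disjI1[OF h0], symmetric] Z_def
      by (rule arg_cong[where f = "power_int h"], simp add: algebra_simps)+
    show "qpoch_inf3 ?b (h powi (2 * (2 * int r - int i - int p + 2 * int u + 2 * int l) - 1))
        (h powi (2 * (int i + int p - 2 * int u - 2 * int l) + 1)) ?b = T u (2 * l)"
      unfolding a b T_def ..
    show "qpoch_inf3 ?b (h powi (2 * (2 * int r - int i - int p + 2 * int u + 2 * int l) + 1))
        (h powi (2 * (int i + int p - 2 * int u - 2 * int l) - 1)) ?b = T u (2 * l + 1)"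
      unfolding a b T_def ..
  qed
  also have "(\<Sum>u<Suc i. \<Sum>l<Suc p. q powi (int u + int l) * (T u (2 * l) - h * T u (2 * l + 1)))
     = (\<Sum>u<Suc i. \<Sum>l<2 * Suc p. (-1) ^ l * h powi (2 * int u + int l) * T u l)"
    unfolding sum_lessThan_double
  proof (intro sum.cong refl)
    fix u l
    have "h powi (2 * int u + int (2 * l)) = q powi (int u + int l)" "h powi (2 * int u + int (2 * l + 1)) = q powi (int u + int l) * h"
      using power_int_mult_same(1)[OF h0, of _ 1] by (simp_all add: h_powi algebra_simps)
    then show "q powi (int u + int l) * (T u (2 * l) - h * T u (2 * l + 1)) = (-1) ^ (2 * l) * h powi (2 * int u + int (2 * l)) * T u (2 * l)
       + (-1) ^ (2 * l + 1) * h powi (2 * int u + int (2 * l + 1)) * T u (2 * l + 1)"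
      by (simp add: algebra_simps)
  qed
  also have "?pre * ((1 + h powi int (2 * p + 1)) / (2 * qpoch_inf q q)) * (\<Sum>u<Suc i. \<Sum>l<2 * Suc p. (-1) ^ l * h powi (2 * int u + int l) * T u l)
     = (1 + h powi int (2 * p + 1)) / (2 * qpoch_inf q q) * (\<Sum>u<Suc i. \<Sum>l<2 * Suc p. ?pre * ((-1) ^ l * h powi (2 * int u + int l) * T u l))"
    unfolding sum_distrib_left[symmetric] by (simp only: mult_ac)
  finally show ?thesis unfolding shift .
qed

end

theorem theorem2p8:
  fixes q h :: complex and m r i :: nat
  assumes "norm q < 1" and "q \<noteq> 0" and "h\<^sup>2 = q"
    and "r \<ge> 2" and "i \<le> r - 1"
  shows "(lhs_term q h m r i has_sum b_seq q h r i m) (index_tuples m r)"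
proof -
  have h0: "h \<noteq> 0" using assms(2,3) by auto
  have norm_h: "norm h < 1"
    using assms(1) unfolding assms(3)[symmetric] norm_power by (simp add: power_less_one_iff)
  interpret half_nome h q using h0 norm_h assms(3) by unfold_locales auto
  obtain k where r: "r = Suc k" using assms(4) by (cases r) auto
  have k: "1 \<le> k" and i: "i \<le> k" using assms(4,5) r by auto
  let ?V = "\<Sum>u<Suc i. \<Sum>l<Suc m. (-1) ^ l * h powi (2 * int m * int u + int m * int l) *
       qpoch_inf3 (q ^ (2 * r))
         (h powi (2 * int r + int m * (2 * int r - 1) - 2 * int i + 4 * int u + 2 * int l))
         (q ^ (2 * r) / h powi (2 * int r + int m * (2 * int r - 1) - 2 * int i + 4 * int u + 2 * int l))
         (q ^ (2 * r))"
  have "b_seq q h r i m = (1 + h powi int m) / (2 * qpoch_inf q q) * ?V"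
  proof (cases "even m")
    case True
    then obtain p where "m = 2 * p" by blast
    then show ?thesis using b_even_eq[of r i p] by (simp only: b_seq_def) simp
  next
    case False
    then obtain p where p: "m = 2 * p + 1" by (elim oddE)
    \<comment> \<open>For odd m the number m + 1 of values of \<open>l\<close> is even, as the
      pairing requires.\<close>
    have "Suc m = 2 * Suc p" "m div 2 = p" using p by auto
    then show ?thesis using b_odd_eq[of r i p] assms(4) False unfolding b_seq_def p by simp
  qed
  moreover have "?V = 2 * infsum (\<lambda>j. \<Sum>u<Suc i. theta_term h m k i j u) UNIV"
  proof -
    have "2 * int r - 1 = 2 * int k + 1" using r by simp
    then show ?thesis unfolding infsum_theta_term by (simp only: r)
  qed
  ultimately have "b_seq q h r i m = (1 + h powi int m) / qpoch_inf q q * infsum (\<lambda>j. \<Sum>u<Suc i. theta_term h m k i j u) UNIV"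
    by (simp only:) simp
  moreover have "(lhs_term q h m r i has_sum infsum (lhs_term q h m r i) (index_tuples m r)) (index_tuples m r)"
    unfolding r by (intro has_sum_infsum abs_summable_summable[OF lhs_term_abs_summable[OF i k]])
  ultimately show ?thesis
    using infsum_lhs_term[OF i k, of m] unfolding r by simp
qed

end
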